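(* Let $(G,S)$ be an F-Lie group and let $\mathcal D_{\text{Pois}}$ be its Poisson-algebra distribution. Then $\mathcal D_{\text{Pois}}$ is an involutive distribution; specifically, the space of left-invariant vector fields $\mathcal D_{\text{Pois}}$ is a Lie subalgebra of the Lie algebra $\mathfrak X^+(G)$.
   Context: An F-manifold is a smooth manifold $M$ with a $C^\infty(M)$-bilinear, associative and commutative product $\circ$ on $\mathfrak X(M)$ such that the Leibnizator $$L(X,Y,Z):=[X,Y\circ Z]-[X,Y]\circ Z-Y\circ[X,Z]$$ satisfies the Hertling-Manin condition $L(X\circ Y,Z,W)=L(X,Z,W)\circ Y+X\circ L(Y,Z,W)$ for all vector fields $X,Y,Z,W$ (no unit for $\circ$ is required). It is also denoted $(M,S)$, where $S$ is the symmetric $(1,2)$-tensor field $S(X,Y)=X\circ Y$. An F-Lie group $(G,S)$ is an F-manifold whose underlying manifold $G$ is a simply connected Lie group and whose product $\circ$ is left-invariant, i.e. the product of two left-invariant vector fields is left-invariant. $\mathfrak X^+(G)$ is the space of left-invariant vector fields. The Poisson-algebra distribution is $$\mathcal D_{\text{Pois}}:=\{u^+\in\mathfrak X^+(G):\mathcal L_{u^+}S=0\}=\{u^+\in\mathfrak X^+(G): L(u^+,v^+,w^+)=0\ \ \forall v^+,w^+\in\mathfrak X^+(G)\};$$ it is identified with the left-invariant subbundle of $TG$ whose fiber at $g\in G$ is $\{u^+_g: u^+\in\mathcal D_{\text{Pois}}\}$. *)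

theory Defs
  imports "HOL-Analysis.Analysis" "HOL-Algebra.Group" "HOL-Library.Function_Algebras"
begin

section \<open>Smooth manifolds\<close>

text \<open>
  For open \<open>U\<close> and a finite-dimensional domain, \<open>Ck_on k f U\<close> says that \<open>f\<close> is of class \<open>C\<^sup>k\<close>:
  all iterated directional derivatives up to order \<open>k\<close> exist and are continuous.
\<close>

fun Ck_on :: "nat \<Rightarrow> ('a::real_normed_vector \<Rightarrow> 'b::real_normed_vector) \<Rightarrow> 'a set \<Rightarrow> bool" where
  "Ck_on 0 f U \<longleftrightarrow> continuous_on U f"
| "Ck_on (Suc k) f U \<longleftrightarrow>
     (\<forall>x\<in>U. f differentiable (at x)) \<and> (\<forall>v. Ck_on k (\<lambda>x. frechet_derivative f (at x) v) U)"

definition smooth_on :: "('a::real_normed_vector \<Rightarrow> 'b::real_normed_vector) \<Rightarrow> 'a set \<Rightarrow> bool" where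
  "smooth_on f U \<longleftrightarrow> (\<forall>k. Ck_on k f U)"

type_synonym ('a, 'e) chart = "'a set \<times> ('a \<Rightarrow> 'e)"
type_synonym ('a, 'e) atlas = "('a, 'e) chart set"

definition is_chart :: "('a::topological_space, 'e::real_normed_vector) chart \<Rightarrow> bool" where
  "is_chart = (\<lambda>(U, \<phi>). open U \<and> open (\<phi> ` U) \<and> homeomorphism U (\<phi> ` U) \<phi> (inv_into U \<phi>))"

text \<open>
  The underlying space is the whole type \<open>'a\<close>; the smooth structure is the one generated by the
  atlas \<open>A\<close>, which need not be maximal. The model space \<open>'e\<close> is a finite-dimensional real inner
  product space rather than a type of class \<^class>\<open>euclidean_space\<close>, because the latter excludes
  dimension \<open>0\<close>.
\<close>

locale smooth_manifold =
  fixes A :: "('a::{t2_space, second_countable_topology}, 'e::real_inner) atlas"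
  assumes finite_dim: "\<exists>B::'e set. finite B \<and> span B = UNIV"
    and charts: "c \<in> A \<Longrightarrow> is_chart c"
    and cover: "(\<Union>(U, \<phi>)\<in>A. U) = UNIV"
    and compatible: "(U, \<phi>) \<in> A \<Longrightarrow> (V, \<psi>) \<in> A \<Longrightarrow> smooth_on (\<psi> \<circ> inv_into U \<phi>) (\<phi> ` (U \<inter> V))"

definition smooth_map ::
  "('a::topological_space, 'e::real_normed_vector) atlas \<Rightarrow>
   ('b::topological_space, 'f::real_normed_vector) atlas \<Rightarrow> ('a \<Rightarrow> 'b) \<Rightarrow> bool" where
  "smooth_map A B F \<longleftrightarrow> continuous_on UNIV F \<and>
     (\<forall>(U, \<phi>)\<in>A. \<forall>(V, \<psi>)\<in>B. smooth_on (\<psi> \<circ> F \<circ> inv_into U \<phi>) (\<phi> ` (U \<inter> F -` V)))"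

definition prod_atlas :: "('a, 'e) atlas \<Rightarrow> ('b, 'f) atlas \<Rightarrow> ('a \<times> 'b, 'e \<times> 'f) atlas" where
  "prod_atlas A B = {(U \<times> V, map_prod \<phi> \<psi>) | U \<phi> V \<psi>. (U, \<phi>) \<in> A \<and> (V, \<psi>) \<in> B}"

definition smooth_functions ::
  "('a::topological_space, 'e::real_normed_vector) atlas \<Rightarrow> ('a \<Rightarrow> real) set" where
  "smooth_functions A = {f. \<forall>(U, \<phi>)\<in>A. smooth_on (f \<circ> inv_into U \<phi>) (\<phi> ` U)}"


section \<open>Vector fields\<close>

text \<open>
  Vector fields are the derivations of the algebra of smooth functions. A derivation is represented
  by a total operator that vanishes outside the smooth functions, so that equality of operators
  is equality of vector fields. Addition and subtraction of vector fields are the pointwise ones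
  provided by \<^theory>\<open>HOL-Library.Function_Algebras\<close>.
\<close>

type_synonym 'a vfield = "('a \<Rightarrow> real) \<Rightarrow> ('a \<Rightarrow> real)"

definition vector_fields ::
  "('a::topological_space, 'e::real_normed_vector) atlas \<Rightarrow> 'a vfield set" where
  "vector_fields A = {X.
     (\<forall>f\<in>smooth_functions A. X f \<in> smooth_functions A) \<and>
     (\<forall>f. f \<notin> smooth_functions A \<longrightarrow> X f = 0) \<and>
     (\<forall>f\<in>smooth_functions A. \<forall>g\<in>smooth_functions A. X (f + g) = X f + X g) \<and>
     (\<forall>c. \<forall>f\<in>smooth_functions A. X (\<lambda>p. c * f p) = (\<lambda>p. c * X f p)) \<and>
     (\<forall>f\<in>smooth_functions A. \<forall>g\<in>smooth_functions A. X (f * g) = X f * g + f * X g)}"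

definition scaleF :: "('a \<Rightarrow> real) \<Rightarrow> 'a vfield \<Rightarrow> 'a vfield" where
  "scaleF h X = (\<lambda>f. h * X f)"

abbreviation scaleC :: "real \<Rightarrow> 'a vfield \<Rightarrow> 'a vfield" where
  "scaleC c X \<equiv> scaleF (\<lambda>p. c) X"

definition lie_bracket :: "'a vfield \<Rightarrow> 'a vfield \<Rightarrow> 'a vfield" where
  "lie_bracket X Y = (\<lambda>f. X (Y f) - Y (X f))"

definition vec_at :: "'a vfield \<Rightarrow> 'a \<Rightarrow> (('a \<Rightarrow> real) \<Rightarrow> real)" where
  "vec_at X p = (\<lambda>f. X f p)"


section \<open>Distributions\<close>

text \<open>
  A distribution is given by its fibers. It is smooth of rank \<open>k\<close> if near every point it is framed
  by \<open>k\<close> smooth vector fields; since local fields extend after shrinking the neighbourhood,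
  these may be taken to be global.
\<close>

type_synonym 'a distribution = "'a \<Rightarrow> (('a \<Rightarrow> real) \<Rightarrow> real) set"

definition smooth_distribution ::
  "('a::topological_space, 'e::real_normed_vector) atlas \<Rightarrow> nat \<Rightarrow> 'a distribution \<Rightarrow> bool" where
  "smooth_distribution A k E \<longleftrightarrow>
     (\<forall>p. \<exists>U (X :: nat \<Rightarrow> 'a vfield). open U \<and> p \<in> U \<and> (\<forall>i<k. X i \<in> vector_fields A) \<and>
       (\<forall>q\<in>U. E q = range (\<lambda>c f. \<Sum>i<k. c i * vec_at (X i) q f) \<and>
              (\<forall>c. (\<forall>f. (\<Sum>i<k. c i * vec_at (X i) q f) = 0) \<longrightarrow> (\<forall>i<k. c i = 0))))"

definition tangent_to :: "'a vfield \<Rightarrow> 'a distribution \<Rightarrow> bool" where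
  "tangent_to X E \<longleftrightarrow> (\<forall>p. vec_at X p \<in> E p)"

definition involutive_distribution ::
  "('a::topological_space, 'e::real_normed_vector) atlas \<Rightarrow> 'a distribution \<Rightarrow> bool" where
  "involutive_distribution A E \<longleftrightarrow>
     (\<exists>k. smooth_distribution A k E) \<and>
     (\<forall>X\<in>vector_fields A. \<forall>Y\<in>vector_fields A.
        tangent_to X E \<longrightarrow> tangent_to Y E \<longrightarrow> tangent_to (lie_bracket X Y) E)"

definition lie_subalgebra :: "'a vfield set \<Rightarrow> 'a vfield set \<Rightarrow> bool" where
  "lie_subalgebra H L \<longleftrightarrow> H \<subseteq> L \<and> 0 \<in> H \<and> (\<forall>X\<in>H. \<forall>Y\<in>H. X + Y \<in> H) \<and>
     (\<forall>c. \<forall>X\<in>H. scaleC c X \<in> H) \<and> (\<forall>X\<in>H. \<forall>Y\<in>H. lie_bracket X Y \<in> H)"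


section \<open>F-manifolds\<close>

definition leibnizator ::
  "('a vfield \<Rightarrow> 'a vfield \<Rightarrow> 'a vfield) \<Rightarrow> 'a vfield \<Rightarrow> 'a vfield \<Rightarrow> 'a vfield \<Rightarrow> 'a vfield" where
  "leibnizator S X Y Z = lie_bracket X (S Y Z) - S (lie_bracket X Y) Z - S Y (lie_bracket X Z)"

locale F_manifold = smooth_manifold A
  for A :: "('a::{t2_space, second_countable_topology}, 'e::real_inner) atlas" +
  fixes S :: "'a vfield \<Rightarrow> 'a vfield \<Rightarrow> 'a vfield"
  assumes S_closed:
      "X \<in> vector_fields A \<Longrightarrow> Y \<in> vector_fields A \<Longrightarrow> S X Y \<in> vector_fields A"
    and S_add_left:
      "X \<in> vector_fields A \<Longrightarrow> Y \<in> vector_fields A \<Longrightarrow> Z \<in> vector_fields A \<Longrightarrow>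
        S (X + Y) Z = S X Z + S Y Z"
    and S_scale_left:
      "h \<in> smooth_functions A \<Longrightarrow> X \<in> vector_fields A \<Longrightarrow> Y \<in> vector_fields A \<Longrightarrow>
        S (scaleF h X) Y = scaleF h (S X Y)"
    and S_add_right:
      "X \<in> vector_fields A \<Longrightarrow> Y \<in> vector_fields A \<Longrightarrow> Z \<in> vector_fields A \<Longrightarrow>
        S X (Y + Z) = S X Y + S X Z"
    and S_scale_right:
      "h \<in> smooth_functions A \<Longrightarrow> X \<in> vector_fields A \<Longrightarrow> Y \<in> vector_fields A \<Longrightarrow>
        S X (scaleF h Y) = scaleF h (S X Y)"
    and S_commute:
      "X \<in> vector_fields A \<Longrightarrow> Y \<in> vector_fields A \<Longrightarrow> S X Y = S Y X"
    and S_assoc: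
      "X \<in> vector_fields A \<Longrightarrow> Y \<in> vector_fields A \<Longrightarrow> Z \<in> vector_fields A \<Longrightarrow>
        S (S X Y) Z = S X (S Y Z)"
    and Hertling_Manin:
      "X \<in> vector_fields A \<Longrightarrow> Y \<in> vector_fields A \<Longrightarrow> Z \<in> vector_fields A \<Longrightarrow>
        W \<in> vector_fields A \<Longrightarrow>
        leibnizator S (S X Y) Z W = S (leibnizator S X Z W) Y + S X (leibnizator S Y Z W)"


section \<open>F-Lie groups\<close>

locale lie_group = group G + smooth_manifold A
  for G :: "'a::{t2_space, second_countable_topology} monoid" (structure)
    and A :: "('a, 'e::real_inner) atlas" +
  assumes carrier_UNIV: "carrier G = UNIV"
    and smooth_mult: "smooth_map (prod_atlas A A) A (\<lambda>(x, y). x \<otimes> y)"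
    and smooth_inv: "smooth_map A A (\<lambda>x. inv x)"

text \<open>Left-invariance of \<open>X\<close>, i.e. \<open>(dL\<^sub>g) X\<^sub>h = X\<^sub>g\<^sub>h\<close>, evaluated on smooth functions.\<close>

definition left_invariant_fields ::
  "'a monoid \<Rightarrow> ('a::topological_space, 'e::real_normed_vector) atlas \<Rightarrow> 'a vfield set" where
  "left_invariant_fields G A = {X \<in> vector_fields A.
     \<forall>g. \<forall>f\<in>smooth_functions A. X (\<lambda>h. f (g \<otimes>\<^bsub>G\<^esub> h)) = (\<lambda>h. X f (g \<otimes>\<^bsub>G\<^esub> h))}"

locale F_Lie_group = lie_group G A + F_manifold A S
  for G :: "'a::{t2_space, second_countable_topology} monoid" (structure)
    and A :: "('a, 'e::real_inner) atlas"
    and S :: "'a vfield \<Rightarrow> 'a vfield \<Rightarrow> 'a vfield" +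
  assumes simply_connected: "simply_connected (UNIV :: 'a set)"
    and S_left_invariant:
      "u \<in> left_invariant_fields G A \<Longrightarrow> v \<in> left_invariant_fields G A \<Longrightarrow>
        S u v \<in> left_invariant_fields G A"

text \<open>
  The Leibnizator is the Lie derivative of the tensor \<open>S\<close>: \<open>(\<L>\<^sub>X S)(Y, Z) = L(X, Y, Z)\<close>.
  As \<open>L(X, Y, Z)\<close> is tensorial in \<open>Y\<close> and \<open>Z\<close>, testing \<open>\<L>\<^sub>u S = 0\<close> on all vector fields is the same
  as testing it on the left-invariant ones.
\<close>

definition D_Pois ::
  "'a monoid \<Rightarrow> ('a::topological_space, 'e::real_normed_vector) atlas \<Rightarrow>
   ('a vfield \<Rightarrow> 'a vfield \<Rightarrow> 'a vfield) \<Rightarrow> 'a vfield set" where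
  "D_Pois G A S = {u \<in> left_invariant_fields G A.
     \<forall>Y\<in>vector_fields A. \<forall>Z\<in>vector_fields A. leibnizator S u Y Z = 0}"

definition fibers :: "'a vfield set \<Rightarrow> 'a distribution" where
  "fibers D = (\<lambda>g. (\<lambda>u. vec_at u g) ` D)"

end

theory Submission
  imports Defs
begin

text \<open>
  A field \<open>u\<close> lies in \<open>D_Pois\<close> iff \<open>ad u\<close> is a derivation of \<open>S\<close>; derivations are closed under
  commutators, so \<open>D_Pois\<close> is a Lie algebra by the Jacobi identity. A left-invariant field is determined
  by its tangent vector at one point, so a basis of any Lie algebra \<open>D\<close> of left-invariant fields is a
  global frame of its fibers; finite-dimensionality comes from Hadamard's lemma and bump functions,
  which identify vector fields at a point with directional derivatives. For involutivity at \<open>q\<close>, write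
  \<open>X = \<Sum> a\<^sub>c E\<^sub>c\<close> and \<open>Y = \<Sum> b\<^sub>c E\<^sub>c\<close> in this frame. If all \<open>E\<^sub>c f\<close> vanish at \<open>q\<close>, then
  continuity of the coefficients already gives
  \<open>[X, Y] f (q) = \<Sum> a\<^sub>c(q) b\<^sub>d(q) [E\<^sub>c, E\<^sub>d] f (q) = 0\<close>, because \<open>[E\<^sub>c, E\<^sub>d] \<in> D\<close>; hence
  \<open>[X, Y]\<close> is at \<open>q\<close> a combination of the \<open>E\<^sub>c\<close>.
\<close>

section \<open>Functions of class \<open>C\<^sup>k\<close>\<close>

text \<open>\<open>frechet_derivative\<close> looks at a full neighbourhood of a point, so agreement
  on \<open>U\<close> passes to the derivatives because \<open>U\<close> is open. Induction then
  compares the derivatives in place of the functions.\<close>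

lemma Ck_on_cong:
  assumes "open U" "\<And>x. x \<in> U \<Longrightarrow> f x = g x" "Ck_on k f U"
  shows "Ck_on k g U"
  using assms(2,3)
proof (induction k arbitrary: f g)
  case 0
  then show ?case by (simp cong: continuous_on_cong)
next
  case (Suc k)
  have g: "(g has_derivative frechet_derivative f (at x)) (at x)" if "x \<in> U" for x
  proof (rule has_derivative_transform_within_open[OF _ assms(1) that])
    show "(f has_derivative frechet_derivative f (at x)) (at x)"
      using that Suc.prems(2) frechet_derivative_works by auto
  qed (use Suc.prems(1) in simp)
  have "Ck_on k (\<lambda>x. frechet_derivative g (at x) v) U" for v
  proof (rule Suc.IH)
    show "Ck_on k (\<lambda>x. frechet_derivative f (at x) v) U"
      using Suc.prems(2) by simp
  qed (use frechet_derivative_at[OF g] in metis)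
  with g show ?case by (auto simp: differentiable_def)
qed

text \<open>Lets the closure lemmas below supply an explicit derivative \<open>f'\<close> in place
  of the choice operator \<open>frechet_derivative\<close>.\<close>

lemma Ck_on_SucI:
  assumes "open U" "\<And>x. x \<in> U \<Longrightarrow> (f has_derivative f' x) (at x)"
    and "\<And>v. Ck_on k (\<lambda>x. f' x v) U"
  shows "Ck_on (Suc k) f U"
proof -
  have "Ck_on k (\<lambda>x. frechet_derivative f (at x) v) U" for v
    by (rule Ck_on_cong[OF assms(1) _ assms(3)[of v]]) (metis assms(2) frechet_derivative_at)
  with assms(2) show ?thesis by (auto simp: differentiable_def)
qed

lemma Ck_on_Suc_has_derivative:
  "Ck_on (Suc k) f U \<Longrightarrow> x \<in> U \<Longrightarrow> (f has_derivative frechet_derivative f (at x)) (at x)"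
  using frechet_derivative_works by auto

lemma Ck_on_Suc_derivative: "Ck_on (Suc k) f U \<Longrightarrow> Ck_on k (\<lambda>x. frechet_derivative f (at x) v) U"
  by simp

lemma Ck_on_Suc_D: "Ck_on (Suc k) f U \<Longrightarrow> Ck_on k f U"
proof (induction k arbitrary: f)
  case 0
  then show ?case
    by (auto intro!: continuous_at_imp_continuous_on differentiable_imp_continuous_within)
next
  case (Suc k)
  then show ?case by (metis Ck_on.simps(2))
qed

lemma Ck_on_subset: "Ck_on k f U \<Longrightarrow> V \<subseteq> U \<Longrightarrow> Ck_on k f V"
  by (induction k arbitrary: f) (auto intro: continuous_on_subset)

text \<open>Being of class \<open>Ck_on k\<close> is a local property; this glues the two
  descriptions of a bump function in \<open>chart_bump_smooth\<close>.\<close>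

lemma Ck_on_local:
  assumes "\<And>x. x \<in> U \<Longrightarrow> \<exists>V. open V \<and> x \<in> V \<and> Ck_on k f V"
  shows "Ck_on k f U"
  using assms
proof (induction k arbitrary: f)
  case 0
  show ?case
    unfolding Ck_on.simps
  proof (rule continuous_at_imp_continuous_on, rule ballI)
    fix x assume "x \<in> U"
    then obtain V where "open V" "x \<in> V" "continuous_on V f"
      using 0 by auto
    then show "continuous (at x) f"
      by (simp add: continuous_on_eq_continuous_at)
  qed
next
  case (Suc k)
  have "f differentiable at x" if "x \<in> U" for x
    using Suc.prems[OF that] by auto
  moreover have "Ck_on k (\<lambda>x. frechet_derivative f (at x) v) U" for v
  proof (rule Suc.IH)
    fix x assume "x \<in> U"
    then obtain V where "open V" "x \<in> V" "Ck_on (Suc k) f V"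
      using Suc.prems by blast
    then show "\<exists>V. open V \<and> x \<in> V \<and> Ck_on k (\<lambda>x. frechet_derivative f (at x) v) V"
      by auto
  qed
  ultimately show ?case by simp
qed

lemma Ck_on_const: "Ck_on k (\<lambda>x. c) U"
  by (induction k arbitrary: c) auto

lemma Ck_on_linear:
  assumes "open U" "bounded_linear L" "Ck_on k f U"
  shows "Ck_on k (\<lambda>x. L (f x)) U"
  using assms(3)
proof (induction k arbitrary: f)
  case 0
  then show ?case using assms(2) by (simp add: bounded_linear.continuous_on)
next
  case (Suc k)
  show ?case
    by (rule Ck_on_SucI[OF assms(1)
          bounded_linear.has_derivative[OF assms(2) Ck_on_Suc_has_derivative[OF Suc.prems]]
          Suc.IH[OF Ck_on_Suc_derivative[OF Suc.prems]]])
qed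

lemma Ck_on_id:
  assumes "open U"
  shows "Ck_on k (\<lambda>x. x) U"
proof (cases k)
  case (Suc l)
  then show ?thesis
    by (simp only:) (rule Ck_on_SucI[OF assms has_derivative_ident Ck_on_const])
qed simp

lemma Ck_on_add:
  assumes "open U" "Ck_on k f U" "Ck_on k g U"
  shows "Ck_on k (\<lambda>x. f x + g x) U"
  using assms(2,3)
proof (induction k arbitrary: f g)
  case 0
  then show ?case by (simp add: continuous_on_add)
next
  case (Suc k)
  show ?case
    by (rule Ck_on_SucI[OF assms(1)
          has_derivative_add[OF Suc.prems[THEN Ck_on_Suc_has_derivative]]
          Suc.IH[OF Suc.prems[THEN Ck_on_Suc_derivative]]])
qed

text \<open>Each term of the product rule keeps one undifferentiated factor, which
  \<open>Ck_on_Suc_D\<close> lowers to class \<open>k\<close> for the induction hypothesis.\<close>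

lemma Ck_on_bilinear:
  assumes "open U" "bounded_bilinear mul" "Ck_on k f U" "Ck_on k g U"
  shows "Ck_on k (\<lambda>x. mul (f x) (g x)) U"
  using assms(3,4)
proof (induction k arbitrary: f g)
  case 0
  then show ?case using assms(2) by (simp add: bounded_bilinear.continuous_on)
next
  case (Suc k)
  show ?case
    by (rule Ck_on_SucI[OF assms(1)
          bounded_bilinear.FDERIV[OF assms(2) Suc.prems[THEN Ck_on_Suc_has_derivative]]
          Ck_on_add[OF assms(1)
            Suc.IH[OF Suc.prems(1)[THEN Ck_on_Suc_D] Suc.prems(2)[THEN Ck_on_Suc_derivative]]
            Suc.IH[OF Suc.prems(1)[THEN Ck_on_Suc_derivative] Suc.prems(2)[THEN Ck_on_Suc_D]]]])
qed

lemmas Ck_on_mult = Ck_on_bilinear[OF _ bounded_bilinear_mult]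
  and Ck_on_inner = Ck_on_bilinear[OF _ bounded_bilinear_inner]

lemma Ck_on_sum:
  assumes "open U" "\<And>i. i \<in> I \<Longrightarrow> Ck_on k (f i) U"
  shows "Ck_on k (\<lambda>x. \<Sum>i\<in>I. f i x) U"
  using assms(2) by (induction I rule: infinite_finite_induct)
    (auto intro: Ck_on_add Ck_on_const assms(1))

section \<open>Orthonormal bases and the chain rule\<close>

text \<open>The model space is only of class \<open>real_inner\<close>, so a basis is carried as an
  explicit set. Finiteness is included because the expansions below are sums over
  \<open>B\<close>.\<close>

definition orthonormal :: "'a::real_inner set \<Rightarrow> bool" where
  "orthonormal B \<longleftrightarrow> finite B \<and> (\<forall>b\<in>B. \<forall>c\<in>B. b \<bullet> c = (if b = c then 1 else 0))"

lemma orthonormal_expand: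
  assumes "orthonormal B" "x \<in> span B"
  shows "(\<Sum>b\<in>B. (x \<bullet> b) *\<^sub>R b) = x"
  using assms(2)
proof (induction rule: span_induct_alt)
  case base
  then show ?case by simp
next
  case (step c b y)
  have "(\<Sum>b'\<in>B. ((c *\<^sub>R b + y) \<bullet> b') *\<^sub>R b') =
      c *\<^sub>R (\<Sum>b'\<in>B. (b \<bullet> b') *\<^sub>R b') + (\<Sum>b'\<in>B. (y \<bullet> b') *\<^sub>R b')"
    by (simp add: algebra_simps scaleR_sum_right sum.distrib)
  moreover have "(\<Sum>b'\<in>B. (b \<bullet> b') *\<^sub>R b') = (\<Sum>b'\<in>B. if b = b' then b' else 0)"
    using assms(1) step.hyps by (intro sum.cong) (auto simp: orthonormal_def)
  moreover have "\<dots> = b"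
    using assms(1) step.hyps by (simp add: orthonormal_def)
  ultimately show ?case using step.IH by simp
qed

lemma orthonormal_basis_subspace:
  fixes V :: "'a::real_inner set"
  assumes "finite F" "span F = (UNIV :: 'a set)" "subspace V"
  obtains B where "orthonormal B" "span B = V"
proof -
  obtain C where C: "C \<subseteq> V" "independent C" "V \<subseteq> span C"
    using maximal_independent_subset by blast
  have "finite C"
    using independent_span_bound[OF assms(1) C(2)] assms(2) by auto
  then obtain D where D: "finite D" "span D = span C" "pairwise orthogonal D"
    using basis_orthogonal[of C] by blast
  let ?B = "(\<lambda>d. d /\<^sub>R norm d) ` (D - {0})"
  have "span ?B = span (D - {0})"
    by (rule span_image_scale) (use D in auto)
  also have "\<dots> = V"
    using D(2) span_minimal[OF C(1) assms(3)] C(3) by simp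
  finally have "span ?B = V" .
  moreover have "orthonormal ?B"
    unfolding orthonormal_def
  proof (intro conjI ballI)
    fix b c assume "b \<in> ?B" "c \<in> ?B"
    then obtain d e where de: "d \<in> D" "d \<noteq> 0" "e \<in> D" "e \<noteq> 0"
      "b = d /\<^sub>R norm d" "c = e /\<^sub>R norm e" by auto
    show "b \<bullet> c = (if b = c then 1 else 0)"
    proof (cases "d = e")
      case True
      then show ?thesis using de by (simp add: dot_square_norm power2_eq_square)
    next
      case False
      then have "b \<bullet> c = 0" using de D(3) by (simp add: pairwise_def orthogonal_def)
      moreover have "b \<bullet> b \<noteq> 0" using de by simp
      ultimately show ?thesis by auto
    qed
  qed (use D(1) in simp)
  ultimately show thesis using that by blast
qed

text \<open>\<open>Ck_on\<close> speaks of derivatives in fixed directions, whereas the chain rule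
  differentiates \<open>f\<close> in the moving direction \<open>?g' x v\<close>. Expanding that
  direction in \<open>B\<close> leaves products of a coordinate of \<open>?g' x v\<close> with a
  derivative of \<open>f\<close> in a fixed direction, to which the induction hypothesis
  applies.\<close>

lemma Ck_on_compose:
  fixes f :: "'b::real_inner \<Rightarrow> real" and g :: "'a::real_normed_vector \<Rightarrow> 'b"
  assumes "open U" "open W" and B: "orthonormal B" "span B = (UNIV :: 'b set)"
    and "Ck_on k f W" "Ck_on k g U" "g ` U \<subseteq> W"
  shows "Ck_on k (\<lambda>x. f (g x)) U"
  using assms(5,6)
proof (induction k arbitrary: f)
  case 0
  then show ?case using continuous_on_compose2 assms(7) by auto
next
  case (Suc k)
  let ?f' = "\<lambda>x. frechet_derivative f (at x)" and ?g' = "\<lambda>x. frechet_derivative g (at x)"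
  have "((\<lambda>x. f (g x)) has_derivative (\<lambda>v. \<Sum>b\<in>B. (?g' x v \<bullet> b) * ?f' (g x) b)) (at x)"
    if "x \<in> U" for x
  proof -
    have f: "(f has_derivative ?f' (g x)) (at (g x))"
      using that assms(7) Suc.prems(1) Ck_on_Suc_has_derivative by blast
    then interpret Df: bounded_linear "?f' (g x)"
      by (rule has_derivative_bounded_linear)
    have expand: "?f' (g x) w = (\<Sum>b\<in>B. (w \<bullet> b) * ?f' (g x) b)" for w
      using arg_cong[OF orthonormal_expand[OF B(1), of w], of "?f' (g x)"] B(2)
      by (simp add: Df.sum Df.scaleR)
    have "((\<lambda>x. f (g x)) has_derivative (\<lambda>v. ?f' (g x) (?g' x v))) (at x)"
      by (rule has_derivative_compose[OF Ck_on_Suc_has_derivative[OF Suc.prems(2) that] f])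
    then show ?thesis
      by (rule has_derivative_eq_rhs) (rule ext, rule expand)
  qed
  moreover have "Ck_on k (\<lambda>x. \<Sum>b\<in>B. (?g' x v \<bullet> b) * ?f' (g x) b) U" for v
  proof (intro Ck_on_sum Ck_on_mult assms(1))
    fix b
    show "Ck_on k (\<lambda>x. ?g' x v \<bullet> b) U"
      by (rule Ck_on_linear[OF assms(1) bounded_linear_inner_left
            Ck_on_Suc_derivative[OF Suc.prems(2)]])
    show "Ck_on k (\<lambda>x. ?f' (g x) b) U"
      by (rule Suc.IH[OF Suc.prems(1)[THEN Ck_on_Suc_derivative] Suc.prems(2)[THEN Ck_on_Suc_D]])
  qed
  ultimately show ?case by (intro Ck_on_SucI[OF assms(1)])
qed

section \<open>A flat function\<close>

text \<open>For \<open>n = 0\<close> this is the classical smooth function \<open>exp (- 1 / x)\<close> that is flat at \<open>0\<close>;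
  the powers of \<open>x\<close> make the family closed under differentiation.\<close>

definition flat :: "nat \<Rightarrow> real \<Rightarrow> real" where
  "flat n x = (if x > 0 then exp (- inverse x) * inverse x ^ n else 0)"

text \<open>From the right, the substitution of \<open>inverse x\<close> reduces this to the
  exponential outgrowing every power.\<close>

lemma flat_tendsto_0: "(flat n \<longlongrightarrow> 0) (at 0)"
proof (rule filterlim_split_at_real)
  show "(flat n \<longlongrightarrow> 0) (at_left 0)"
    by (rule tendsto_eventually) (auto simp: eventually_at flat_def intro!: exI[of _ 1])
  have "((\<lambda>x::real. inverse x ^ n / exp (inverse x)) \<longlongrightarrow> 0) (at_right 0)"
    by (rule filterlim_compose[OF tendsto_power_div_exp_0 filterlim_inverse_at_top_right])
  then show "(flat n \<longlongrightarrow> 0) (at_right 0)"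
  proof (rule Lim_transform_eventually)
    show "\<forall>\<^sub>F x in at_right 0. inverse x ^ n / exp (inverse x) = flat n x"
      by (auto simp: eventually_at_filter flat_def exp_minus field_simps)
  qed
qed

lemma flat_has_derivative:
  "(flat n has_real_derivative flat (n + 2) x - real n * flat (n + 1) x) (at x)"
proof -
  consider "x < 0" | "x = 0" | "x > 0" by linarith
  then show ?thesis
  proof cases
    case 1
    have "((\<lambda>x::real. 0) has_real_derivative 0) (at x)" by simp
    then have "(flat n has_real_derivative 0) (at x)"
      by (rule has_field_derivative_transform_within_open[of _ _ _ "{..<0}"])
        (use 1 in \<open>auto simp: flat_def\<close>)
    then show ?thesis using 1 by (simp add: flat_def)
  next
    case 2
    \<comment> \<open>The difference quotient of \<open>flat n\<close> at 0 is the next member of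
      the family, so the derivative there is its limit, which is 0.\<close>
    have "flat (n + 1) = (\<lambda>y. (flat n y - flat n 0) / (y - 0))"
      by (rule ext) (simp add: flat_def divide_inverse)
    then have "(flat n has_real_derivative 0) (at 0)"
      unfolding has_field_derivative_iff using flat_tendsto_0[of "n + 1"] by metis
    then show ?thesis using 2 by (simp add: flat_def)
  next
    case 3
    have e: "((\<lambda>x. exp (- inverse x)) has_real_derivative exp (- inverse x) * inverse x ^ 2) (at x)"
      using 3 by (auto intro!: derivative_eq_intros simp: power2_eq_square)
    have p: "((\<lambda>x. inverse x ^ n) has_real_derivative - (real n * inverse x ^ (n + 1))) (at x)"
    proof (cases n)
      case (Suc m)
      show ?thesis unfolding Suc
        by (rule DERIV_cong[OF DERIV_power[OF DERIV_inverse]])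
          (use 3 in \<open>auto simp: power2_eq_square\<close>)
    qed simp
    have "((\<lambda>x. exp (- inverse x) * inverse x ^ n) has_real_derivative
        flat (n + 2) x - real n * flat (n + 1) x) (at x)"
      by (rule DERIV_cong[OF DERIV_mult[OF e p]])
        (use 3 in \<open>simp add: flat_def algebra_simps power2_eq_square\<close>)
    then show ?thesis
      by (rule has_field_derivative_transform_within_open[of _ _ _ "{0<..}"])
        (use 3 in \<open>auto simp: flat_def\<close>)
  qed
qed

lemma Ck_on_flat: "Ck_on k (flat n) UNIV"
proof (induction k arbitrary: n)
  case 0
  then show ?case
    by (auto intro!: continuous_at_imp_continuous_on DERIV_isCont[OF flat_has_derivative])
next
  case (Suc k)
  show ?case
  proof (rule Ck_on_SucI[OF open_UNIV])
    show "(flat n has_derivative (*) (flat (n + 2) x + (- real n) * flat (n + 1) x)) (at x)" for x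
      using flat_has_derivative[of n x] by (simp add: has_field_derivative_def)
    show "Ck_on k (\<lambda>x. (flat (n + 2) x + (- real n) * flat (n + 1) x) * v) UNIV" for v
      by (intro Ck_on_mult Ck_on_add Ck_on_const Suc open_UNIV)
  qed
qed

section \<open>Hadamard's lemma\<close>

text \<open>A weighted integral of \<open>f\<close> along the segment from \<open>a\<close> to
  \<open>x\<close>. The case \<open>m = 0\<close> gives the coefficients in Hadamard's lemma; higher
  weights arise because each differentiation in \<open>x\<close> brings out a factor
  \<open>t\<close>.\<close>

definition ray_integral :: "nat \<Rightarrow> ('a::real_normed_vector \<Rightarrow> real) \<Rightarrow> 'a \<Rightarrow> 'a \<Rightarrow> real" where
  "ray_integral m f a x = integral {0..1} (\<lambda>t. t ^ m * f (a + t *\<^sub>R (x - a)))"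

lemma ray_in_ball:
  fixes a :: "'a::real_normed_vector"
  assumes "x \<in> ball a r" "t \<in> {0..1}"
  shows "a + t *\<^sub>R (x - a) \<in> ball a r"
proof -
  have "\<bar>t\<bar> * norm (x - a) \<le> 1 * norm (x - a)"
    using assms(2) by (intro mult_right_mono) auto
  then show ?thesis using assms(1) by (simp add: dist_norm norm_minus_commute)
qed

lemma continuous_on_ray:
  fixes a :: "'a::real_normed_vector" and f :: "'a \<Rightarrow> real"
  assumes "continuous_on (ball a r) f"
  shows "continuous_on (ball a r \<times> {0..1}) (\<lambda>(x, t). t ^ m * f (a + t *\<^sub>R (x - a)))"
proof -
  have "continuous_on (ball a r \<times> {0..1}) (\<lambda>p. f (a + snd p *\<^sub>R (fst p - a)))"
    by (intro continuous_intros continuous_on_compose2[OF assms]) (use ray_in_ball in force)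
  then show ?thesis
    by (simp add: case_prod_unfold) (intro continuous_intros)
qed

lemma has_ray_integral:
  fixes a :: "'a::real_normed_vector"
  assumes "continuous_on (ball a r) f" "x \<in> ball a r"
  shows "((\<lambda>t. t ^ m * f (a + t *\<^sub>R (x - a))) has_integral ray_integral m f a x) {0..1}"
  unfolding ray_integral_def
proof (intro integrable_integral integrable_continuous_real)
  show "continuous_on {0..1} (\<lambda>t. t ^ m * f (a + t *\<^sub>R (x - a)))"
    by (intro continuous_intros continuous_on_compose2[OF assms(1)])
      (use ray_in_ball[OF assms(2)] in blast)
qed

lemma continuous_on_ray_integral:
  fixes a :: "'a::real_normed_vector"
  assumes "continuous_on (ball a r) f"
  shows "continuous_on (ball a r) (ray_integral m f a)"
  unfolding ray_integral_def
  using integral_continuous_on_param[of "ball a r" 0 1 "\<lambda>x t. t ^ m * f (a + t *\<^sub>R (x - a))"]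
    continuous_on_ray[OF assms] by simp

text \<open>The chain rule for the scaling by \<open>t\<close>, expanded in \<open>B\<close> so that
  its coefficients are \<open>t\<close> times derivatives of \<open>f\<close> in fixed
  directions.\<close>

lemma ray_derivative:
  fixes a :: "'a::real_inner" and f :: "'a \<Rightarrow> real"
  assumes B: "orthonormal B" "span B = UNIV"
    and "Ck_on (Suc k) f (ball a r)" "x \<in> ball a r" "t \<in> {0..1}"
  shows "((\<lambda>x. f (a + t *\<^sub>R (x - a))) has_derivative
    (\<lambda>v. \<Sum>b\<in>B. (v \<bullet> b) * (t * frechet_derivative f (at (a + t *\<^sub>R (x - a))) b))) (at x)"
proof -
  let ?f' = "frechet_derivative f (at (a + t *\<^sub>R (x - a)))"
  have f: "(f has_derivative ?f') (at (a + t *\<^sub>R (x - a)))"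
    by (rule Ck_on_Suc_has_derivative[OF assms(3) ray_in_ball[OF assms(4,5)]])
  then interpret Df: bounded_linear ?f'
    by (rule has_derivative_bounded_linear)
  have "((\<lambda>x. a + t *\<^sub>R (x - a)) has_derivative (\<lambda>v. t *\<^sub>R v)) (at x)"
    by (auto intro!: derivative_eq_intros)
  then have "((\<lambda>x. f (a + t *\<^sub>R (x - a))) has_derivative (\<lambda>v. ?f' (t *\<^sub>R v))) (at x)"
    by (rule has_derivative_compose) (rule f)
  then show ?thesis
  proof (rule has_derivative_eq_rhs, intro ext)
    fix v
    have "?f' (t *\<^sub>R v) = t * ?f' (\<Sum>b\<in>B. (v \<bullet> b) *\<^sub>R b)"
      using orthonormal_expand[OF B(1), of v] B(2) by (simp add: Df.scaleR)
    also have "\<dots> = (\<Sum>b\<in>B. (v \<bullet> b) * (t * ?f' b))"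
      by (simp add: Df.sum Df.scaleR sum_distrib_left mult.left_commute)
    finally show "?f' (t *\<^sub>R v) = \<dots>" .
  qed
qed

section \<open>Differentiation under the integral sign\<close>

text \<open>Makes the first-order remainder small uniformly in \<open>t\<close>. Compactness of
  \<open>{0..1}\<close> makes the continuity of the derivatives at \<open>x\<close> uniform in
  \<open>t\<close>, and the mean value inequality on a ball turns this into the estimate.\<close>

lemma ray_linearization:
  fixes a :: "'a::real_inner" and f :: "'a \<Rightarrow> real"
  assumes B: "orthonormal B" "span B = UNIV"
    and f: "Ck_on 1 f (ball a r)" and x: "x \<in> ball a r" and "e > 0"
  obtains d where "d > 0" "ball x d \<subseteq> ball a r"
    "\<forall>y\<in>ball x d. \<forall>t\<in>{0..1}.
      \<bar>f (a + t *\<^sub>R (y - a)) - f (a + t *\<^sub>R (x - a))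
        - (\<Sum>b\<in>B. ((y - x) \<bullet> b) * (t * frechet_derivative f (at (a + t *\<^sub>R (x - a))) b))\<bar>
      \<le> e * norm (y - x)"
proof -
  let ?D = "\<lambda>y t b. frechet_derivative f (at (a + t *\<^sub>R (y - a))) b"
  have finB: "finite B" using B(1) by (simp add: orthonormal_def)
  \<comment> \<open>An error \<open>e / N\<close> in each of the \<open>card B\<close> directions
    adds up to at most \<open>e\<close>; the summand 1 keeps \<open>N\<close> positive when
    \<open>B\<close> is empty.\<close>
  define N where "N = real (card B) + 1"
  have N: "N > 0" by (simp add: N_def)
  have "\<forall>b\<in>B. \<exists>d>0. ball x d \<subseteq> ball a r \<and>
      (\<forall>y\<in>ball x d. \<forall>t\<in>{0..1}. \<bar>t * ?D y t b - t * ?D x t b\<bar> \<le> e / N)"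
  proof
    fix b assume "b \<in> B"
    have "continuous_on (ball a r) (\<lambda>x. frechet_derivative f (at x) b)"
      using f by simp
    then have "continuous_on (ball a r \<times> {0..1}) (\<lambda>(x, t). t ^ 1 * ?D x t b)"
      by (rule continuous_on_ray)
    from continuous_on_prod_compactE[OF this _ x, of "e / N"] N \<open>e > 0\<close>
    obtain X where X: "x \<in> X" "open X"
      "\<forall>y\<in>X \<inter> ball a r. \<forall>t\<in>{0..1}. dist (t * ?D y t b) (t * ?D x t b) \<le> e / N"
      by auto
    then obtain d where "d > 0" "ball x d \<subseteq> X \<inter> ball a r"
      using x by (metis IntI open_Int open_ball open_contains_ball)
    with X(3) show "\<exists>d>0. ball x d \<subseteq> ball a r \<and>
        (\<forall>y\<in>ball x d. \<forall>t\<in>{0..1}. \<bar>t * ?D y t b - t * ?D x t b\<bar> \<le> e / N)"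
      by (intro exI[of _ d]) (auto simp: dist_real_def)
  qed
  then obtain d where d: "\<And>b. b \<in> B \<Longrightarrow> d b > 0 \<and> ball x (d b) \<subseteq> ball a r \<and>
      (\<forall>y\<in>ball x (d b). \<forall>t\<in>{0..1}. \<bar>t * ?D y t b - t * ?D x t b\<bar> \<le> e / N)"
    by metis
  obtain d0 where d0: "d0 > 0" "ball x d0 \<subseteq> ball a r"
    using x open_ball open_contains_ball by metis
  \<comment> \<open>Inserting \<open>d0\<close> keeps the minimum meaningful when \<open>B\<close>
    is empty.\<close>
  define \<delta> where "\<delta> = Min (insert d0 (d ` B))"
  have \<delta>: "\<delta> > 0" "\<delta> \<le> d0" "\<And>b. b \<in> B \<Longrightarrow> \<delta> \<le> d b"
    using finB d d0 by (auto simp: \<delta>_def)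
  show thesis
  proof
    show "\<delta> > 0" by fact
    show sub: "ball x \<delta> \<subseteq> ball a r"
      using \<delta>(2) d0(2) by force
    show "\<forall>y\<in>ball x \<delta>. \<forall>t\<in>{0..1}. \<bar>f (a + t *\<^sub>R (y - a)) - f (a + t *\<^sub>R (x - a))
        - (\<Sum>b\<in>B. ((y - x) \<bullet> b) * (t * ?D x t b))\<bar> \<le> e * norm (y - x)"
    proof (intro ballI)
      fix y t assume y: "y \<in> ball x \<delta>" and t: "t \<in> {0..1::real}"
      let ?f' = "\<lambda>y v. \<Sum>b\<in>B. (v \<bullet> b) * (t * ?D y t b)"
      have "norm (f (a + t *\<^sub>R (y - a)) - f (a + t *\<^sub>R (x - a)) - ?f' x (y - x))
          \<le> norm (y - x) * e"
      proof (rule differentiable_bound_linearization[where S = "ball x \<delta>" and f' = ?f'])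
        show "x + s *\<^sub>R (y - x) \<in> ball x \<delta>" if "s \<in> {0..1}" for s
          by (rule ray_in_ball[OF y that])
        show "((\<lambda>x. f (a + t *\<^sub>R (x - a))) has_derivative ?f' z) (at z within ball x \<delta>)"
          if "z \<in> ball x \<delta>" for z
          by (rule has_derivative_at_withinI[OF ray_derivative[OF B, where k = 0]])
            (use f t that sub in auto)
        show "onorm (?f' z - ?f' x) \<le> e" if z: "z \<in> ball x \<delta>" for z
        proof (rule onorm_bound)
          fix v
          have "norm ((?f' z - ?f' x) v) = \<bar>\<Sum>b\<in>B. (v \<bullet> b) * (t * ?D z t b - t * ?D x t b)\<bar>"
            by (simp add: sum_subtractf algebra_simps)
          also have "\<dots> \<le> (\<Sum>b\<in>B. \<bar>(v \<bullet> b) * (t * ?D z t b - t * ?D x t b)\<bar>)"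
            by (rule sum_abs)
          also have "\<dots> \<le> (\<Sum>b\<in>B. norm v * (e / N))"
          proof (rule sum_mono)
            fix b assume b: "b \<in> B"
            have "norm b = 1"
              using B(1) b by (simp add: orthonormal_def norm_eq_sqrt_inner)
            then have "\<bar>v \<bullet> b\<bar> \<le> norm v"
              using Cauchy_Schwarz_ineq2[of v b] by simp
            moreover have "\<bar>t * ?D z t b - t * ?D x t b\<bar> \<le> e / N"
              using d[OF b] t z \<delta>(3)[OF b] by auto
            ultimately show "\<bar>(v \<bullet> b) * (t * ?D z t b - t * ?D x t b)\<bar> \<le> norm v * (e / N)"
              unfolding abs_mult by (intro mult_mono) auto
          qed
          also have "\<dots> = norm v * e * (real (card B) / N)"
            by simp
          also have "\<dots> \<le> norm v * e * 1"
            using \<open>e > 0\<close> N by (intro mult_left_mono) (auto simp: N_def)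
          finally show "norm ((?f' z - ?f' x) v) \<le> e * norm v"
            by (simp add: mult.commute)
        qed (use \<open>e > 0\<close> in simp)
        show "x \<in> ball x \<delta>" using \<delta>(1) by simp
      qed
      then show "\<bar>f (a + t *\<^sub>R (y - a)) - f (a + t *\<^sub>R (x - a)) - ?f' x (y - x)\<bar>
          \<le> e * norm (y - x)"
        by (simp add: mult.commute)
    qed
  qed
qed

text \<open>Integrating the uniform estimate of \<open>ray_linearization\<close> over
  \<open>t\<close> bounds the remainder of the integral. The factor \<open>t\<close> of the inner
  derivative raises the weight from \<open>m\<close> to \<open>Suc m\<close>.\<close>

lemma ray_integral_has_derivative:
  fixes a :: "'a::real_inner" and f :: "'a \<Rightarrow> real"
  assumes B: "orthonormal B" "span B = UNIV"
    and f: "Ck_on 1 f (ball a r)" and x: "x \<in> ball a r"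
  shows "(ray_integral m f a has_derivative
    (\<lambda>v. \<Sum>b\<in>B. (v \<bullet> b) * ray_integral (Suc m) (\<lambda>x. frechet_derivative f (at x) b) a x)) (at x)"
    (is "(_ has_derivative ?K') _")
  unfolding has_derivative_within_alt
proof (intro conjI allI impI)
  show "bounded_linear ?K'"
    by (intro bounded_linear_sum bounded_linear_mult_const bounded_linear_inner_left)
  fix e :: real assume "e > 0"
  obtain d where d: "d > 0" "ball x d \<subseteq> ball a r"
    "\<forall>y\<in>ball x d. \<forall>t\<in>{0..1}.
      \<bar>f (a + t *\<^sub>R (y - a)) - f (a + t *\<^sub>R (x - a))
        - (\<Sum>b\<in>B. ((y - x) \<bullet> b) * (t * frechet_derivative f (at (a + t *\<^sub>R (x - a))) b))\<bar>
      \<le> e * norm (y - x)"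
    using ray_linearization[OF B f x \<open>e > 0\<close>] by blast
  have cont: "continuous_on (ball a r) f"
    using Ck_on_Suc_D[of 0 f] f by simp
  have cont': "continuous_on (ball a r) (\<lambda>x. frechet_derivative f (at x) b)" for b
    using f by simp
  have "norm (ray_integral m f a y - ray_integral m f a x - ?K' (y - x)) \<le> e * norm (y - x)"
    if y: "norm (y - x) < d" for y
  proof -
    have y': "y \<in> ball x d" "y \<in> ball a r"
      using y d(2) by (auto simp: dist_norm norm_minus_commute)
    let ?R = "\<lambda>t. t ^ m * f (a + t *\<^sub>R (y - a)) - t ^ m * f (a + t *\<^sub>R (x - a))
      - (\<Sum>b\<in>B. ((y - x) \<bullet> b) * (t ^ Suc m * frechet_derivative f (at (a + t *\<^sub>R (x - a))) b))"
    have fin: "finite B" using B(1) by (simp add: orthonormal_def)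
    have "(?R has_integral (ray_integral m f a y - ray_integral m f a x - ?K' (y - x))) {0..1}"
      by (intro has_integral_diff has_integral_sum fin has_integral_mult_right
          has_ray_integral[OF cont] has_ray_integral[OF cont'] x y')
    then have "norm (ray_integral m f a y - ray_integral m f a x - ?K' (y - x))
        \<le> e * norm (y - x) * measure lborel {0..1::real}"
    proof (rule has_integral_bound_real[rotated 2])
      show "norm (?R t) \<le> e * norm (y - x)" if t: "t \<in> {0..1} - {}" for t
      proof -
        let ?Q = "f (a + t *\<^sub>R (y - a)) - f (a + t *\<^sub>R (x - a))
          - (\<Sum>b\<in>B. ((y - x) \<bullet> b) * (t * frechet_derivative f (at (a + t *\<^sub>R (x - a))) b))"
        have "?R t = t ^ m * ?Q"
          by (simp add: algebra_simps sum_distrib_left)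
        then have "norm (?R t) = t ^ m * \<bar>?Q\<bar>"
          using t by (simp only: real_norm_def abs_mult) simp
        also have "\<dots> \<le> 1 * (e * norm (y - x))"
          by (intro mult_mono d(3)[rule_format] y') (use t in \<open>auto intro: power_le_one\<close>)
        finally show ?thesis by simp
      qed
    qed (use \<open>e > 0\<close> in auto)
    then show ?thesis by simp
  qed
  with d(1) show "\<exists>d>0. \<forall>y\<in>UNIV. norm (y - x) < d \<longrightarrow>
      norm (ray_integral m f a y - ray_integral m f a x - ?K' (y - x)) \<le> e * norm (y - x)"
    by blast
qed

text \<open>The derivatives of a ray integral are again combinations of ray integrals, with weight
  \<open>Suc m\<close>; hence the induction generalises over \<open>m\<close>.\<close>

lemma Ck_on_ray_integral:
  fixes a :: "'a::real_inner" and f :: "'a \<Rightarrow> real"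
  assumes B: "orthonormal B" "span B = (UNIV :: 'a set)" and "Ck_on k f (ball a r)"
  shows "Ck_on k (ray_integral m f a) (ball a r)"
  using assms(3)
proof (induction k arbitrary: f m)
  case 0
  then show ?case by (simp add: continuous_on_ray_integral)
next
  case (Suc k)
  have f: "Ck_on 1 f (ball a r)"
    using Suc.prems by (induction k) (auto dest: Ck_on_Suc_D simp del: Ck_on.simps)
  show ?case
    by (rule Ck_on_SucI[OF open_ball ray_integral_has_derivative[OF B f]], assumption)
      (intro Ck_on_sum Ck_on_mult Ck_on_const open_ball Suc.IH Ck_on_Suc_derivative Suc.prems)
qed

text \<open>The fundamental theorem of calculus for \<open>f\<close> along the segment from
  \<open>a\<close> to \<open>x\<close>, with the derivative in direction \<open>x - a\<close>
  expanded in \<open>B\<close>.\<close>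

lemma Hadamard:
  fixes a :: "'a::real_inner" and f :: "'a \<Rightarrow> real"
  assumes B: "orthonormal B" "span B = UNIV"
    and f: "Ck_on 1 f (ball a r)" and x: "x \<in> ball a r"
  shows "f x = f a +
    (\<Sum>b\<in>B. ((x - a) \<bullet> b) * ray_integral 0 (\<lambda>x. frechet_derivative f (at x) b) a x)"
proof -
  let ?D = "\<lambda>t. frechet_derivative f (at (a + t *\<^sub>R (x - a)))"
  have "((\<lambda>t. \<Sum>b\<in>B. ((x - a) \<bullet> b) * ?D t b) has_integral
      f (a + 1 *\<^sub>R (x - a)) - f (a + 0 *\<^sub>R (x - a))) {0..1}"
  proof (rule fundamental_theorem_of_calculus)
    fix t :: real assume t: "t \<in> {0..1}"
    have f': "(f has_derivative ?D t) (at (a + t *\<^sub>R (x - a)))"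
      by (rule Ck_on_Suc_has_derivative[of 0]) (use f ray_in_ball[OF x t] in auto)
    then interpret Df: bounded_linear "?D t"
      by (rule has_derivative_bounded_linear)
    have "((\<lambda>t. a + t *\<^sub>R (x - a)) has_derivative (\<lambda>s. s *\<^sub>R (x - a))) (at t within {0..1})"
      by (auto intro!: derivative_eq_intros)
    then have "((\<lambda>t. f (a + t *\<^sub>R (x - a))) has_derivative (\<lambda>s. ?D t (s *\<^sub>R (x - a))))
        (at t within {0..1})"
      by (rule has_derivative_compose) (rule f')
    moreover have "?D t (x - a) = (\<Sum>b\<in>B. ((x - a) \<bullet> b) * ?D t b)"
    proof -
      have "?D t (x - a) = ?D t (\<Sum>b\<in>B. ((x - a) \<bullet> b) *\<^sub>R b)"
        using orthonormal_expand[OF B(1), of "x - a"] B(2) by simp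
      then show ?thesis by (simp add: Df.sum Df.scaleR)
    qed
    ultimately show "((\<lambda>t. f (a + t *\<^sub>R (x - a))) has_vector_derivative
        (\<Sum>b\<in>B. ((x - a) \<bullet> b) * ?D t b)) (at t within {0..1})"
      by (simp add: has_vector_derivative_def Df.scaleR)
  qed simp
  moreover have "((\<lambda>t. \<Sum>b\<in>B. ((x - a) \<bullet> b) * ?D t b) has_integral
      (\<Sum>b\<in>B. ((x - a) \<bullet> b) * ray_integral 0 (\<lambda>x. frechet_derivative f (at x) b) a x)) {0..1}"
    by (intro has_integral_sum has_integral_mult_right has_ray_integral[where m = 0, unfolded power_0 mult_1, OF _ x])
      (use f B(1) in \<open>auto simp: orthonormal_def\<close>)
  ultimately have "f (a + 1 *\<^sub>R (x - a)) - f (a + 0 *\<^sub>R (x - a)) =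
      (\<Sum>b\<in>B. ((x - a) \<bullet> b) * ray_integral 0 (\<lambda>x. frechet_derivative f (at x) b) a x)"
    by (rule has_integral_unique)
  then show ?thesis by simp
qed

text \<open>Applied to a partial derivative of a function, this shows that its Hadamard coefficient
  at the base point is that partial derivative.\<close>

lemma ray_integral_center: "ray_integral 0 f a a = f a"
  by (simp add: ray_integral_def)

section \<open>Smooth functions on a manifold\<close>

text \<open>A cube is compact because it is built one coordinate at a time as a continuous image of
  a product of compact sets. The ball about 0 is a closed part of the cube, and translation moves it
  to \<open>a\<close>.\<close>

lemma compact_cball_finite_dim:
  fixes a :: "'e::real_inner"
  assumes B: "orthonormal B" "span B = (UNIV :: 'e set)"
  shows "compact (cball a r)"
proof -
  define K where "K F = (\<lambda>c. \<Sum>b\<in>F. c b *\<^sub>R b) ` {c. \<forall>b::'e. \<bar>c b\<bar> \<le> r}" for F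
  have "compact (K F)" if "finite F" for F
    using that
  proof (induction F)
    case empty
    have "K {} \<subseteq> {0}" by (auto simp: K_def)
    then show ?case using finite_imp_compact finite_subset by blast
  next
    case (insert b F)
    have "K (insert b F) = (\<lambda>(t, x). t *\<^sub>R b + x) ` ({-r..r} \<times> K F)" (is "_ = ?R")
    proof
      show "K (insert b F) \<subseteq> ?R"
        using insert.hyps by (force simp: K_def abs_le_iff)
      show "?R \<subseteq> K (insert b F)"
      proof clarify
        fix t x assume t: "t \<in> {-r..r}" and "x \<in> K F"
        then obtain c where c: "\<forall>b. \<bar>c b\<bar> \<le> r" "x = (\<Sum>b\<in>F. c b *\<^sub>R b)"
          by (auto simp: K_def)
        have "(\<Sum>b'\<in>F. (c(b := t)) b' *\<^sub>R b') = x"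
          unfolding c(2) using insert.hyps by (intro sum.cong) auto
        then show "t *\<^sub>R b + x \<in> K (insert b F)"
          unfolding K_def using insert.hyps c(1) t
          by (intro image_eqI[of _ _ "c(b := t)"]) auto
      qed
    qed
    also have "compact \<dots>"
      unfolding case_prod_unfold
      by (intro compact_continuous_image compact_Times insert.IH continuous_intros) auto
    finally show ?case .
  qed
  then have "compact (K B)" using B(1) by (simp add: orthonormal_def)
  moreover have "cball 0 r \<subseteq> K B"
  proof
    fix x :: 'e assume x: "x \<in> cball 0 r"
    \<comment> \<open>Membership in \<open>K B\<close> bounds \<open>c\<close> on all vectors, so
      \<open>c\<close> is set to 0 outside \<open>B\<close>.\<close>
    define c where "c b = (if b \<in> B then x \<bullet> b else 0)" for b
    have "\<bar>c b\<bar> \<le> r" for b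
    proof (cases "b \<in> B")
      case True
      then have "norm b = 1" using B(1) by (simp add: orthonormal_def norm_eq_sqrt_inner)
      then show ?thesis using Cauchy_Schwarz_ineq2[of x b] x True by (simp add: c_def)
    next
      case False
      then show ?thesis using x norm_ge_zero[of x] by (simp add: c_def del: norm_ge_zero)
    qed
    moreover have "x = (\<Sum>b\<in>B. c b *\<^sub>R b)"
      using orthonormal_expand[OF B(1), of x] B(2) by (simp add: c_def)
    ultimately show "x \<in> K B" unfolding K_def by blast
  qed
  ultimately have "compact (K B \<inter> cball 0 r)" "cball 0 r = K B \<inter> cball 0 r"
    by (auto intro: compact_Int_closed)
  then have "compact ((+) a ` cball 0 r)"
    by (metis compact_translation)
  then show ?thesis by (metis cball_translation add.right_neutral add.commute)
qed

context smooth_manifold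
begin

lemma chartD:
  assumes "(U, \<phi>) \<in> A"
  shows "open U" "open (\<phi> ` U)" "inj_on \<phi> U" "continuous_on U \<phi>"
    "continuous_on (\<phi> ` U) (inv_into U \<phi>)"
proof -
  have c: "open U" "open (\<phi> ` U)" "homeomorphism U (\<phi> ` U) \<phi> (inv_into U \<phi>)"
    using charts[OF assms] by (auto simp: is_chart_def)
  then show "open U" "open (\<phi> ` U)" "continuous_on U \<phi>" "continuous_on (\<phi> ` U) (inv_into U \<phi>)"
    by (auto simp: homeomorphism_def)
  show "inj_on \<phi> U"
    using c(3) by (metis homeomorphism_def inj_on_inverseI)
qed

lemma chart_at:
  obtains U \<phi> where "(U, \<phi>) \<in> A" "p \<in> U"
proof -
  have "p \<in> (\<Union>(U, \<phi>)\<in>A. U)" using cover by simp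
  then show thesis using that by auto
qed

lemma chart_open_image:
  assumes "(U, \<phi>) \<in> A" "open W" "W \<subseteq> U"
  shows "open (\<phi> ` W)"
proof -
  have "\<phi> ` W = \<phi> ` U \<inter> inv_into U \<phi> -` W"
    using assms(3) chartD(3)[OF assms(1)] by (force simp: inv_into_f_f)
  then show ?thesis
    using continuous_open_preimage[OF chartD(5,2)[OF assms(1)] assms(2)] by simp
qed

lemma smooth_functions_Ck:
  "f \<in> smooth_functions A \<Longrightarrow> (U, \<phi>) \<in> A \<Longrightarrow> Ck_on k (f \<circ> inv_into U \<phi>) (\<phi> ` U)"
  by (auto simp: smooth_functions_def smooth_on_def)

lemma smooth_functionsI:
  "(\<And>U \<phi> k. (U, \<phi>) \<in> A \<Longrightarrow> Ck_on k (\<lambda>x. f (inv_into U \<phi> x)) (\<phi> ` U)) \<Longrightarrow>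
    f \<in> smooth_functions A"
  by (auto simp: smooth_functions_def smooth_on_def o_def)

lemma smooth_functions_const: "(\<lambda>p. c) \<in> smooth_functions A"
  by (intro smooth_functionsI Ck_on_const)

lemma smooth_functions_add:
  "f \<in> smooth_functions A \<Longrightarrow> g \<in> smooth_functions A \<Longrightarrow> f + g \<in> smooth_functions A"
  using smooth_functions_Ck[unfolded o_def] chartD(2)
  by (auto intro!: smooth_functionsI Ck_on_add)

lemma smooth_functions_mult:
  "f \<in> smooth_functions A \<Longrightarrow> g \<in> smooth_functions A \<Longrightarrow> f * g \<in> smooth_functions A"
  using smooth_functions_Ck[unfolded o_def] chartD(2)
  by (auto intro!: smooth_functionsI Ck_on_mult)

lemma smooth_functions_scale:
  "f \<in> smooth_functions A \<Longrightarrow> (\<lambda>p. c * f p) \<in> smooth_functions A"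
  using smooth_functions_mult[OF smooth_functions_const[of c], of f] by (simp add: times_fun_def)

lemma smooth_functions_sum:
  "(\<And>i. i \<in> I \<Longrightarrow> f i \<in> smooth_functions A) \<Longrightarrow> (\<Sum>i\<in>I. f i) \<in> smooth_functions A"
  using smooth_functions_const[of 0]
  by (induction I rule: infinite_finite_induct) (auto simp: zero_fun_def intro: smooth_functions_add)

lemma smooth_functions_diff:
  assumes "f \<in> smooth_functions A" "g \<in> smooth_functions A"
  shows "f - g \<in> smooth_functions A"
proof -
  have "f - g = f + (\<lambda>p. (-1) * g p)" by auto
  then show ?thesis using assms by (simp only: smooth_functions_add smooth_functions_scale)
qed

lemma orthonormal_basis_model:
  obtains B :: "'e set" where "orthonormal B" "span B = UNIV"
  using finite_dim orthonormal_basis_subspace[OF _ _ subspace_UNIV] by metis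

lemma smooth_functions_continuous_at:
  assumes "f \<in> smooth_functions A"
  shows "isCont f p"
proof -
  obtain U \<phi> where c: "(U, \<phi>) \<in> A" "p \<in> U" by (rule chart_at)
  have "continuous_on (\<phi> ` U) (f \<circ> inv_into U \<phi>)"
    using smooth_functions_Ck[OF assms c(1), of 0] by simp
  then have "continuous_on U ((f \<circ> inv_into U \<phi>) \<circ> \<phi>)"
    by (rule continuous_on_compose[OF chartD(4)[OF c(1)]])
  then have "continuous_on U f"
    by (rule continuous_on_eq) (use chartD(3)[OF c(1)] in auto)
  then show ?thesis using c(2) chartD(1)[OF c(1)] by (simp add: continuous_on_eq_continuous_at)
qed

section \<open>Bump functions supported in a chart\<close>

text \<open>The flat factor is positive exactly where \<open>\<phi> p\<close> lies in the open ball
  of radius \<open>r\<close> about \<open>a\<close>. The factor \<open>k\<close> makes this a device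
  for cutting off a function given in coordinates and extending it to the whole manifold.\<close>

definition chart_bump :: "'a set \<Rightarrow> ('a \<Rightarrow> 'e) \<Rightarrow> 'e \<Rightarrow> real \<Rightarrow> ('e \<Rightarrow> real) \<Rightarrow> 'a \<Rightarrow> real" where
  "chart_bump U \<phi> a r k p =
     (if p \<in> U then flat 0 (r\<^sup>2 - (\<phi> p - a) \<bullet> (\<phi> p - a)) * k (\<phi> p) else 0)"

lemma chart_bump_eq_0:
  assumes "p \<in> U \<Longrightarrow> \<phi> p \<notin> cball a r" "r > 0"
  shows "chart_bump U \<phi> a r k p = 0"
proof (cases "p \<in> U")
  case True
  then have "r < norm (\<phi> p - a)"
    using assms(1) by (simp add: dist_norm norm_minus_commute)
  then have "r\<^sup>2 \<le> (\<phi> p - a) \<bullet> (\<phi> p - a)"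
    unfolding power2_norm_eq_inner[symmetric] using assms(2) by (intro power_mono) auto
  then show ?thesis by (simp add: chart_bump_def flat_def)
qed (simp add: chart_bump_def)

text \<open>The preimage \<open>C\<close> of the closed ball is compact, hence closed in the
  Hausdorff manifold. The open set \<open>W\<close> and the complement of \<open>C\<close> cover the
  manifold: on \<open>W\<close> the function is a composition of smooth maps, off \<open>C\<close>
  it is 0. The gap between \<open>r\<close> and \<open>R\<close> gives
  \<open>C \<subseteq> W\<close>.\<close>

lemma chart_bump_smooth:
  assumes c: "(U, \<phi>) \<in> A" and r: "0 < r" "r < R" "ball a R \<subseteq> \<phi> ` U"
    and k: "\<And>n. Ck_on n k (ball a R)"
  shows "chart_bump U \<phi> a r k \<in> smooth_functions A"
proof (rule smooth_functionsI)
  fix V \<psi> n assume d: "(V, \<psi>) \<in> A"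
  obtain B :: "'e set" where B: "orthonormal B" "span B = UNIV"
    by (rule orthonormal_basis_model)
  define W where "W = U \<inter> \<phi> -` ball a R"
  define C where "C = inv_into U \<phi> ` cball a r"
  have "open W"
    unfolding W_def by (rule continuous_open_preimage[OF chartD(4,1)[OF c] open_ball])
  have sub: "cball a r \<subseteq> \<phi> ` U" using r by force
  have "compact C"
    unfolding C_def
    by (intro compact_continuous_image compact_cball_finite_dim[OF B]
        continuous_on_subset[OF chartD(5)[OF c] sub])
  then have "closed C" by (rule compact_imp_closed)
  have C: "p \<in> C" if "p \<in> U" "\<phi> p \<in> cball a r" for p
    unfolding C_def using that chartD(3)[OF c] by (metis image_eqI inv_into_f_f)
  then have zero: "chart_bump U \<phi> a r k p = 0" if "p \<notin> C" for p
    using that r(1) by (intro chart_bump_eq_0) auto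
  have "C \<subseteq> W"
    unfolding C_def W_def using sub r(2) f_inv_into_f[of _ \<phi> U] inv_into_into[of _ \<phi> U]
    by (auto 0 3)
  have inv: "inv_into V \<psi> (\<psi> p) = p" if "p \<in> V" for p
    using that chartD(3)[OF d] by simp
  let ?f = "\<lambda>x. chart_bump U \<phi> a r k (inv_into V \<psi> x)"
  show "Ck_on n ?f (\<psi> ` V)"
  proof (rule Ck_on_local)
    fix x assume "x \<in> \<psi> ` V"
    then obtain p where p: "p \<in> V" "x = \<psi> p" by auto
    show "\<exists>N. open N \<and> x \<in> N \<and> Ck_on n ?f N"
    proof (cases "p \<in> W")
      case True
      let ?N = "\<psi> ` (V \<inter> W)" and ?\<tau> = "\<phi> \<circ> inv_into V \<psi>"
      have N: "open ?N"
        using chart_open_image[OF d] chartD(1)[OF d] \<open>open W\<close> by auto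
      have "Ck_on n ?\<tau> (\<psi> ` (V \<inter> U))"
        using compatible[OF d c] by (simp add: smooth_on_def)
      then have \<tau>: "Ck_on n ?\<tau> ?N"
        by (rule Ck_on_subset) (auto simp: W_def)
      have \<tau>_ball: "?\<tau> ` ?N \<subseteq> ball a R"
        using inv by (auto simp: W_def)
      \<comment> \<open>This is \<open>r\<^sup>2\<close> minus the squared distance to
        \<open>a\<close>, written with sums and products only so that the closure rules
        match.\<close>
      have q: "Ck_on n (\<lambda>y. r\<^sup>2 + (-1) * ((y + - a) \<bullet> (y + - a))) (ball a R)"
        by (intro Ck_on_add Ck_on_mult Ck_on_inner Ck_on_const Ck_on_id open_ball)
      have "Ck_on n (\<lambda>y. flat 0 (r\<^sup>2 + (-1) * ((y + - a) \<bullet> (y + - a)))) (ball a R)"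
        \<comment> \<open>The outer function lives on the reals, whose orthonormal basis is
          \<open>{1}\<close>.\<close>
        by (rule Ck_on_compose[OF open_ball open_UNIV _ _ Ck_on_flat q, where B = "{1}"])
          (auto simp: orthonormal_def span_singleton)
      then have "Ck_on n (\<lambda>y. flat 0 (r\<^sup>2 + (-1) * ((y + - a) \<bullet> (y + - a))) * k y) (ball a R)"
        by (intro Ck_on_mult k open_ball)
      then have "Ck_on n (\<lambda>x. flat 0 (r\<^sup>2 + (-1) * ((?\<tau> x + - a) \<bullet> (?\<tau> x + - a))) * k (?\<tau> x)) ?N"
        by (rule Ck_on_compose[OF N open_ball B _ \<tau> \<tau>_ball])
      then have "Ck_on n ?f ?N"
        by (rule Ck_on_cong[OF N, rotated]) (use inv in \<open>auto simp: chart_bump_def W_def\<close>)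
      with N True p show ?thesis by blast
    next
      case False
      let ?N = "\<psi> ` (V - C)"
      have N: "open ?N"
        using chart_open_image[OF d] chartD(1)[OF d] \<open>closed C\<close> by auto
      have "Ck_on n (\<lambda>x. 0 :: real) ?N" by (rule Ck_on_const)
      then have "Ck_on n ?f ?N"
        by (rule Ck_on_cong[OF N, rotated])
          (use inv zero in auto)
      moreover have "p \<notin> C" using False \<open>C \<subseteq> W\<close> by auto
      ultimately show ?thesis using N p by blast
    qed
  qed
qed

end

section \<open>Vector fields as derivations\<close>

lemma sum_fun_apply: "(\<Sum>i\<in>I. f i) x = (\<Sum>i\<in>I. f i x :: 'b::comm_monoid_add)"
  by (induction I rule: infinite_finite_induct) auto

context smooth_manifold
begin

lemma vector_fieldD:
  assumes "X \<in> vector_fields A"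
  shows "f \<in> smooth_functions A \<Longrightarrow> X f \<in> smooth_functions A"
    and "f \<notin> smooth_functions A \<Longrightarrow> X f = 0"
    and "f \<in> smooth_functions A \<Longrightarrow> g \<in> smooth_functions A \<Longrightarrow> X (f + g) = X f + X g"
    and "f \<in> smooth_functions A \<Longrightarrow> X (\<lambda>p. c * f p) = (\<lambda>p. c * X f p)"
    and "f \<in> smooth_functions A \<Longrightarrow> g \<in> smooth_functions A \<Longrightarrow> X (f * g) = X f * g + f * X g"
  using assms by (auto simp: vector_fields_def)

text \<open>The Leibniz rule for 1 * 1 reads X 1 = X 1 + X 1; homogeneity gives the other
  constants.\<close>

lemma vector_field_const:
  assumes "X \<in> vector_fields A"
  shows "X (\<lambda>p. c) = 0"
proof -
  let ?one = "\<lambda>p. 1 :: real"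
  have "X (?one * ?one) = X ?one * ?one + ?one * X ?one"
    by (intro vector_fieldD(5)[OF assms] smooth_functions_const)
  then have "X ?one p = X ?one p + X ?one p" for p
    by (simp add: times_fun_def plus_fun_def fun_eq_iff)
  then have "X ?one p = 0" for p by simp
  moreover have "X (\<lambda>p. c * ?one p) = (\<lambda>p. c * X ?one p)"
    by (intro vector_fieldD(4)[OF assms] smooth_functions_const)
  ultimately show ?thesis by (simp add: zero_fun_def)
qed

lemma vector_field_zero: "X \<in> vector_fields A \<Longrightarrow> X 0 = 0"
  using vector_field_const[of X 0] by (simp add: zero_fun_def)

lemma vector_field_diff:
  assumes "X \<in> vector_fields A" "f \<in> smooth_functions A" "g \<in> smooth_functions A"
  shows "X (f - g) = X f - X g"
proof -
  have "X f = X ((f - g) + g)" by simp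
  also have "\<dots> = X (f - g) + X g"
    by (intro vector_fieldD(3)[OF assms(1)] smooth_functions_diff assms(2,3))
  finally show ?thesis by simp
qed

lemma vector_field_sum:
  assumes "X \<in> vector_fields A" "\<And>i. i \<in> I \<Longrightarrow> f i \<in> smooth_functions A"
  shows "X (\<Sum>i\<in>I. f i) = (\<Sum>i\<in>I. X (f i))"
  using assms(2)
  by (induction I rule: infinite_finite_induct)
    (simp_all add: vector_field_zero[OF assms(1)] vector_fieldD(3)[OF assms(1)] smooth_functions_sum)

lemma vector_field_linear_combination:
  assumes "X \<in> vector_fields A" "\<And>i. i \<in> I \<Longrightarrow> f i \<in> smooth_functions A"
  shows "X (\<lambda>p. \<Sum>i\<in>I. c i * f i p) = (\<lambda>p. \<Sum>i\<in>I. c i * X (f i) p)"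
proof -
  have "(\<lambda>p. \<Sum>i\<in>I. c i * f i p) = (\<Sum>i\<in>I. (\<lambda>p. c i * f i p))"
    by (auto simp: sum_fun_apply)
  then have "X (\<lambda>p. \<Sum>i\<in>I. c i * f i p) = X (\<Sum>i\<in>I. (\<lambda>p. c i * f i p))"
    by simp
  also have "\<dots> = (\<Sum>i\<in>I. X (\<lambda>p. c i * f i p))"
    by (intro vector_field_sum[OF assms(1)] smooth_functions_scale assms(2))
  also have "\<dots> = (\<Sum>i\<in>I. (\<lambda>p. c i * X (f i) p))"
    by (intro sum.cong refl vector_fieldD(4)[OF assms(1)] assms(2))
  finally show ?thesis by (auto simp: sum_fun_apply)
qed

lemma vector_fields_zero: "0 \<in> vector_fields A"
  using smooth_functions_const[of 0] by (auto simp: vector_fields_def zero_fun_def plus_fun_def times_fun_def)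

lemma vector_fields_add:
  assumes "X \<in> vector_fields A" "Y \<in> vector_fields A"
  shows "X + Y \<in> vector_fields A"
  using assms vector_fieldD[OF assms(1)] vector_fieldD[OF assms(2)]
  by (auto simp: vector_fields_def smooth_functions_add fun_eq_iff algebra_simps)

lemma vector_fields_scaleC:
  assumes "X \<in> vector_fields A"
  shows "scaleC c X \<in> vector_fields A"
  using assms vector_fieldD[OF assms] smooth_functions_scale[of _ c]
  by (auto simp: vector_fields_def scaleF_def times_fun_def fun_eq_iff algebra_simps)

lemma vector_fields_lie_bracket:
  assumes X: "X \<in> vector_fields A" and Y: "Y \<in> vector_fields A"
  shows "lie_bracket X Y \<in> vector_fields A"
  unfolding vector_fields_def
proof (intro CollectI conjI ballI allI impI)
  note x = vector_fieldD[OF X] and y = vector_fieldD[OF Y]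
  fix f assume f: "f \<in> smooth_functions A"
  show "lie_bracket X Y f \<in> smooth_functions A"
    unfolding lie_bracket_def by (intro smooth_functions_diff x y f)
  show "lie_bracket X Y (\<lambda>p. c * f p) = (\<lambda>p. c * lie_bracket X Y f p)" for c
    using f by (auto simp: lie_bracket_def x y algebra_simps)
  fix g assume g: "g \<in> smooth_functions A"
  show "lie_bracket X Y (f + g) = lie_bracket X Y f + lie_bracket X Y g"
    using f g by (simp add: lie_bracket_def x y)
  show "lie_bracket X Y (f * g) = lie_bracket X Y f * g + f * lie_bracket X Y g"
    using f g by (simp add: lie_bracket_def x y smooth_functions_mult algebra_simps)
next
  fix f assume "f \<notin> smooth_functions A"
  then show "lie_bracket X Y f = 0"
    using vector_fieldD(2)[OF X] vector_fieldD(2)[OF Y] vector_field_zero[OF X] vector_field_zero[OF Y]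
    by (simp add: lie_bracket_def)
qed

lemma vector_fields_sum:
  "(\<And>i. i \<in> I \<Longrightarrow> X i \<in> vector_fields A) \<Longrightarrow> (\<Sum>i\<in>I. X i) \<in> vector_fields A"
  by (induction I rule: infinite_finite_induct) (auto intro: vector_fields_zero vector_fields_add)

section \<open>Derivations at a point as directional derivatives\<close>

text \<open>Hadamard's lemma writes \<open>f - f q\<close> near \<open>q\<close> as a sum of
  products of a coordinate function vanishing at \<open>q\<close> with a smooth coefficient. Cutting
  off makes this a global identity, and the Leibniz rule at \<open>q\<close> leaves only the
  derivatives of the coordinate functions. The functions \<open>h b\<close> depend neither on
  \<open>X\<close> nor on \<open>f\<close>.\<close>

lemma vector_field_at_point:
  assumes c: "(U, \<phi>) \<in> A" "q \<in> U" and B: "orthonormal B" "span B = (UNIV :: 'e set)"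
  obtains h where "\<And>b. b \<in> B \<Longrightarrow> h b \<in> smooth_functions A"
    "\<And>X f. X \<in> vector_fields A \<Longrightarrow> f \<in> smooth_functions A \<Longrightarrow>
      X f q = (\<Sum>b\<in>B. X (h b) q * frechet_derivative (f \<circ> inv_into U \<phi>) (at (\<phi> q)) b)"
proof -
  define a where "a = \<phi> q"
  have "a \<in> \<phi> ` U" using c(2) by (simp add: a_def)
  then obtain R where R: "R > 0" "ball a R \<subseteq> \<phi> ` U"
    using chartD(2)[OF c(1)] open_contains_ball by metis
  define r where "r = R / 2"
  have r: "0 < r" "r < R" using R(1) by (auto simp: r_def)
  \<comment> \<open>The factor \<open>s\<close> normalises the bump to the value 1 at
    \<open>q\<close>.\<close>
  define s where "s = 1 / flat 0 (r\<^sup>2)"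
  have "flat 0 (r\<^sup>2) > 0" using r(1) by (simp add: flat_def)
  then have s: "flat 0 (r\<^sup>2) * s = 1" by (simp add: s_def)
  note smooth = chart_bump_smooth[OF c(1) r R(2)]
  let ?bump = "chart_bump U \<phi> a r"
  define \<beta> where "\<beta> = ?bump (\<lambda>y. s)"
  define h where "h b = ?bump (\<lambda>y. s * ((y + - a) \<bullet> b))" for b
  have \<beta>: "\<beta> \<in> smooth_functions A"
    unfolding \<beta>_def by (intro smooth Ck_on_const)
  have h: "h b \<in> smooth_functions A" for b
    unfolding h_def
    by (intro smooth Ck_on_mult Ck_on_inner Ck_on_add Ck_on_const Ck_on_id open_ball)
  have \<beta>q: "\<beta> q = 1" and hq: "h b q = 0" for b
    using s c(2) by (simp_all add: \<beta>_def h_def chart_bump_def a_def)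
  show thesis
  proof (rule that)
    show "h b \<in> smooth_functions A" for b by (rule h)
    fix X f assume X: "X \<in> vector_fields A" and f: "f \<in> smooth_functions A"
    define F where "F = f \<circ> inv_into U \<phi>"
    let ?F' = "\<lambda>b x. frechet_derivative F (at x) b"
    have F: "Ck_on n F (ball a R)" for n
      using Ck_on_subset[OF smooth_functions_Ck[OF f c(1)] R(2)] by (simp add: F_def)
    define g where "g b = ?bump (\<lambda>y. s * ray_integral 0 (?F' b) a y)" for b
    have g: "g b \<in> smooth_functions A" for b
      unfolding g_def
      by (intro smooth Ck_on_mult Ck_on_const Ck_on_ray_integral[OF B] Ck_on_Suc_derivative[OF F]
          open_ball)
    have gq: "g b q = ?F' b a" for b
      using s c(2) by (simp add: g_def chart_bump_def a_def ray_integral_center)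
    let ?f0 = "f - (\<lambda>p. f q)"
    have f0: "?f0 \<in> smooth_functions A"
      by (intro smooth_functions_diff f smooth_functions_const)
    \<comment> \<open>The left side carries the square of the bump because on the right both
      \<open>h b\<close> and \<open>g b\<close> contain one copy. Outside the closed ball both sides
      vanish.\<close>
    have eq: "(\<beta> * \<beta>) * ?f0 = (\<Sum>b\<in>B. h b * g b)"
    proof
      fix p
      show "((\<beta> * \<beta>) * ?f0) p = (\<Sum>b\<in>B. h b * g b) p"
      proof (cases "p \<in> U \<and> \<phi> p \<in> cball a r")
        case True
        then have "\<phi> p \<in> ball a R" using r by auto
        moreover have "F (\<phi> p) = f p" "F a = f q"
          using True c(2) chartD(3)[OF c(1)] by (auto simp: F_def a_def)
        ultimately have "f p - f q =
            (\<Sum>b\<in>B. ((\<phi> p - a) \<bullet> b) * ray_integral 0 (?F' b) a (\<phi> p))"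
          using Hadamard[OF B F, of "\<phi> p"] by simp
        then show ?thesis
          using True
          by (simp add: \<beta>_def h_def g_def chart_bump_def sum_fun_apply sum_distrib_left algebra_simps)
      next
        case False
        then show ?thesis
          using r(1) by (auto simp: \<beta>_def h_def chart_bump_eq_0 sum_fun_apply)
      qed
    qed
    have "X f q = X ?f0 q"
      using vector_field_diff[OF X f smooth_functions_const] vector_field_const[OF X] by simp
    \<comment> \<open>In the Leibniz rule the term differentiating \<open>\<beta> * \<beta>\<close>
      drops out since \<open>?f0\<close> vanishes at \<open>q\<close>, and \<open>\<beta>\<close> is
      1 there.\<close>
    also have "\<dots> = X ((\<beta> * \<beta>) * ?f0) q"
      using vector_fieldD(5)[OF X smooth_functions_mult[OF \<beta> \<beta>] f0] \<beta>q by simp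
    also have "\<dots> = (\<Sum>b\<in>B. X (h b * g b)) q"
      unfolding eq by (subst vector_field_sum[OF X]) (auto intro: smooth_functions_mult h g)
    also have "\<dots> = (\<Sum>b\<in>B. X (h b) q * ?F' b a)"
      using vector_fieldD(5)[OF X h g] hq gq by (simp add: sum_fun_apply)
    finally show "X f q =
        (\<Sum>b\<in>B. X (h b) q * frechet_derivative (f \<circ> inv_into U \<phi>) (at (\<phi> q)) b)"
      by (simp add: F_def a_def)
  qed
qed

text \<open>The tangent vector \<open>T X\<close> of a vector field at the point \<open>q\<close>, in the coordinates of a chart,
  together with globally defined functions that have prescribed differentials at \<open>q\<close>.\<close>

lemma tangent_vector:
  assumes c: "(U, \<phi>) \<in> A" "q \<in> U"
  obtains T :: "'a vfield \<Rightarrow> 'e" and h :: "'e \<Rightarrow> 'a \<Rightarrow> real" where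
    "\<And>v. h v \<in> smooth_functions A"
    "\<And>X v. X \<in> vector_fields A \<Longrightarrow> X (h v) q = T X \<bullet> v"
    "\<And>X f. X \<in> vector_fields A \<Longrightarrow> f \<in> smooth_functions A \<Longrightarrow>
      X f q = frechet_derivative (f \<circ> inv_into U \<phi>) (at (\<phi> q)) (T X)"
proof -
  obtain B :: "'e set" where B: "orthonormal B" "span B = UNIV"
    by (rule orthonormal_basis_model)
  obtain h where h: "\<And>b. b \<in> B \<Longrightarrow> h b \<in> smooth_functions A"
    and X: "\<And>X f. X \<in> vector_fields A \<Longrightarrow> f \<in> smooth_functions A \<Longrightarrow>
      X f q = (\<Sum>b\<in>B. X (h b) q * frechet_derivative (f \<circ> inv_into U \<phi>) (at (\<phi> q)) b)"
    using vector_field_at_point[OF c B] by blast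
  define T where "T X = (\<Sum>b\<in>B. X (h b) q *\<^sub>R b)" for X
  define h' where "h' v p = (\<Sum>b\<in>B. (v \<bullet> b) * h b p)" for v p
  show thesis
  proof (rule that)
    have "h' v = (\<Sum>b\<in>B. (\<lambda>p. (v \<bullet> b) * h b p))" for v
      by (auto simp: h'_def sum_fun_apply)
    then show "h' v \<in> smooth_functions A" for v
      by (simp add: smooth_functions_sum smooth_functions_scale h)
    show "X (h' v) q = T X \<bullet> v" if "X \<in> vector_fields A" for X v
    proof -
      have "X (h' v) q = (\<Sum>b\<in>B. (v \<bullet> b) * X (h b) q)"
        unfolding h'_def[abs_def] by (simp add: vector_field_linear_combination[OF that h])
      then show ?thesis
        by (simp add: T_def inner_sum_left inner_commute[of v] mult.commute)
    qed
    show "X f q = frechet_derivative (f \<circ> inv_into U \<phi>) (at (\<phi> q)) (T X)"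
      if "X \<in> vector_fields A" "f \<in> smooth_functions A" for X f
    proof -
      have "((f \<circ> inv_into U \<phi>) has_derivative frechet_derivative (f \<circ> inv_into U \<phi>) (at (\<phi> q)))
          (at (\<phi> q))"
        by (rule Ck_on_Suc_has_derivative[OF smooth_functions_Ck[OF that(2) c(1)]])
          (use c(2) in simp)
      then interpret Df: bounded_linear "frechet_derivative (f \<circ> inv_into U \<phi>) (at (\<phi> q))"
        by (rule has_derivative_bounded_linear)
      show ?thesis
        using X[OF that] by (simp add: T_def Df.sum Df.scaleR)
    qed
  qed
qed

end

section \<open>Left-invariant fields\<close>

lemma linear_combination_apply:
  "(\<Sum>i\<in>I. scaleC (a i) (X i)) f p = (\<Sum>i\<in>I. a i * X i f p)"
  by (simp add: sum_fun_apply scaleF_def)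

lemma lie_subalgebraD:
  assumes "lie_subalgebra D L"
  shows "X \<in> D \<Longrightarrow> X \<in> L" "0 \<in> D" "X \<in> D \<Longrightarrow> Y \<in> D \<Longrightarrow> X + Y \<in> D"
    "X \<in> D \<Longrightarrow> scaleC c X \<in> D" "X \<in> D \<Longrightarrow> Y \<in> D \<Longrightarrow> lie_bracket X Y \<in> D"
  using assms by (auto simp: lie_subalgebra_def)

lemma lie_subalgebra_linear_combination:
  assumes "lie_subalgebra D L" "\<And>i. i \<in> I \<Longrightarrow> X i \<in> D"
  shows "(\<Sum>i\<in>I. scaleC (a i) (X i)) \<in> D"
  using assms(2) by (induction I rule: infinite_finite_induct)
    (simp_all add: lie_subalgebraD[OF assms(1)])

context lie_group
begin

abbreviation LI :: "'a vfield set" where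
  "LI \<equiv> left_invariant_fields G A"

lemma left_invariant_vector_field: "X \<in> LI \<Longrightarrow> X \<in> vector_fields A"
  by (simp add: left_invariant_fields_def)

lemma left_invariantD:
  "X \<in> LI \<Longrightarrow> f \<in> smooth_functions A \<Longrightarrow> X (\<lambda>h. f (g \<otimes> h)) = (\<lambda>h. X f (g \<otimes> h))"
  by (simp add: left_invariant_fields_def)

text \<open>Left translation by \<open>p \<otimes> inv q\<close> carries \<open>q\<close> to
  \<open>p\<close>, so agreement at \<open>q\<close> spreads to every point.\<close>

lemma left_invariant_eqI:
  assumes X: "X \<in> LI" and Y: "Y \<in> LI" and eq: "\<And>f. f \<in> smooth_functions A \<Longrightarrow> X f q = Y f q"
  shows "X = Y"
proof
  note zero = left_invariant_vector_field[THEN vector_fieldD(2)]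
  fix f
  show "X f = Y f"
  proof (cases "f \<in> smooth_functions A")
    case f: True
    show ?thesis
    proof
      fix p
      let ?g = "p \<otimes> inv q"
      have p: "p = ?g \<otimes> q" by (simp add: m_assoc carrier_UNIV)
      \<comment> \<open>Should the translate fall outside the smooth functions, both fields send it
        to 0 by convention.\<close>
      have "X (\<lambda>h. f (?g \<otimes> h)) q = Y (\<lambda>h. f (?g \<otimes> h)) q"
        using eq zero[OF X] zero[OF Y] by (cases "(\<lambda>h. f (?g \<otimes> h)) \<in> smooth_functions A") auto
      then have "X f (?g \<otimes> q) = Y f (?g \<otimes> q)"
        by (simp only: left_invariantD[OF X f] left_invariantD[OF Y f])
      then show "X f p = Y f p" using p by simp
    qed
  qed (simp add: zero[OF X] zero[OF Y])
qed

lemma left_invariant_lie_subalgebra: "lie_subalgebra LI LI"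
  unfolding lie_subalgebra_def
proof (intro conjI ballI allI subset_refl)
  show "0 \<in> LI"
    by (simp add: left_invariant_fields_def vector_fields_zero fun_eq_iff)
  fix X assume X: "X \<in> LI"
  note x = left_invariant_vector_field[OF X] left_invariantD[OF X]
  show "scaleC c X \<in> LI" for c
    using x by (simp add: left_invariant_fields_def vector_fields_scaleC) (simp add: scaleF_def fun_eq_iff)
  fix Y assume Y: "Y \<in> LI"
  note y = left_invariant_vector_field[OF Y] left_invariantD[OF Y]
  show "X + Y \<in> LI"
    using x y by (simp add: left_invariant_fields_def vector_fields_add fun_eq_iff)
  show "lie_bracket X Y \<in> LI"
    unfolding left_invariant_fields_def
  proof (intro CollectI conjI allI ballI)
    show "lie_bracket X Y \<in> vector_fields A"
      by (rule vector_fields_lie_bracket[OF x(1) y(1)])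
    fix g f assume "f \<in> smooth_functions A"
    then show "lie_bracket X Y (\<lambda>h. f (g \<otimes> h)) = (\<lambda>h. lie_bracket X Y f (g \<otimes> h))"
      using vector_fieldD(1)[OF x(1)] vector_fieldD(1)[OF y(1)]
      by (auto simp: lie_bracket_def fun_diff_def x y)
  qed
qed

end

section \<open>Coefficients that are merely continuous\<close>

text \<open>A product rule for a factor \<open>g\<close> that is only continuous at
  \<open>a\<close>: since \<open>\<psi> a = 0\<close>, the values \<open>\<psi> x\<close> are of
  order \<open>norm (x - a)\<close>, so multiplying them by \<open>g x - g a\<close> gives an error
  of smaller order.\<close>

lemma has_derivative_mult_vanishing:
  fixes g \<psi> :: "'a::real_normed_vector \<Rightarrow> real"
  assumes g: "isCont g a" and \<psi>: "(\<psi> has_derivative \<psi>') (at a)" and "\<psi> a = 0"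
  shows "((\<lambda>x. g x * \<psi> x) has_derivative (\<lambda>v. g a * \<psi>' v)) (at a)"
proof -
  have "((\<lambda>x. (g x - g a) * \<psi> x) has_derivative (\<lambda>v. 0)) (at a)"
    unfolding has_derivative_within_alt
  proof (intro conjI allI impI)
    fix e :: real assume "e > 0"
    obtain K where K: "K > 0" "\<And>w. norm (\<psi>' w) \<le> norm w * K"
      using bounded_linear.pos_bounded[OF has_derivative_bounded_linear[OF \<psi>]] by blast
    obtain d1 where d1: "d1 > 0"
      "\<And>x. norm (x - a) < d1 \<Longrightarrow> norm (\<psi> x - \<psi> a - \<psi>' (x - a)) \<le> 1 * norm (x - a)"
      using \<psi>[unfolded has_derivative_within_alt] zero_less_one by blast
    have "e / (K + 1) > 0" using \<open>e > 0\<close> K(1) by simp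
    then obtain d2 where d2: "d2 > 0" "\<And>x. norm (x - a) < d2 \<Longrightarrow> \<bar>g x - g a\<bar> < e / (K + 1)"
      using g unfolding continuous_at_eps_delta dist_norm real_norm_def by blast
    have "norm ((g x - g a) * \<psi> x) \<le> e * norm (x - a)" if "norm (x - a) < min d1 d2" for x
    proof -
      have "norm (\<psi> x) \<le> (K + 1) * norm (x - a)"
        using d1(2)[of x] K(2)[of "x - a"] that \<open>\<psi> a = 0\<close> by (auto simp: algebra_simps)
      moreover have "\<bar>g x - g a\<bar> \<le> e / (K + 1)"
        using d2(2)[of x] that by simp
      ultimately have "\<bar>g x - g a\<bar> * norm (\<psi> x) \<le> e / (K + 1) * ((K + 1) * norm (x - a))"
        using K(1) \<open>e > 0\<close> by (intro mult_mono) auto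
      then show ?thesis using K(1) by (simp add: abs_mult)
    qed
    then show "\<exists>d>0. \<forall>x\<in>UNIV. norm (x - a) < d \<longrightarrow>
        norm ((g x - g a) * \<psi> x - (g a - g a) * \<psi> a - 0) \<le> e * norm (x - a)"
      using d1(1) d2(1) by (intro exI[of _ "min d1 d2"]) auto
  qed simp
  then have "((\<lambda>x. (g x - g a) * \<psi> x + g a * \<psi> x) has_derivative (\<lambda>v. 0 + g a * \<psi>' v)) (at a)"
    by (intro has_derivative_add has_derivative_mult_right \<psi>)
  then show ?thesis by (simp add: algebra_simps)
qed

text \<open>The matrix \<open>M\<close> tends to the identity, so its inverse stays bounded.\<close>

lemma coefficients_tendsto_0:
  fixes M :: "'c \<Rightarrow> 'c \<Rightarrow> 'p \<Rightarrow> real"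
  assumes "finite C"
    and M: "\<And>c d. c \<in> C \<Longrightarrow> d \<in> C \<Longrightarrow> (M c d \<longlongrightarrow> (if c = d then 1 else 0)) F"
    and y: "\<And>d. d \<in> C \<Longrightarrow> ((\<lambda>p. \<Sum>c\<in>C. g c p * M c d p) \<longlongrightarrow> 0) F"
    and "c \<in> C"
  shows "(g c \<longlongrightarrow> 0) F"
proof -
  let ?y = "\<lambda>d p. \<Sum>c\<in>C. g c p * M c d p" and ?\<delta> = "\<lambda>c d. if c = d then 1 else 0 :: real"
  \<comment> \<open>With this choice the \<open>card C\<close> errors \<open>?G * \<epsilon>\<close>
    add up to \<open>?G / 2\<close>, which is absorbed on the left.\<close>
  define \<epsilon> where "\<epsilon> = 1 / (2 * real (card C))"
  have card: "real (card C) > 0"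
    using assms(1,4) by (auto simp: card_gt_0_iff)
  then have "\<epsilon> > 0" by (simp add: \<epsilon>_def)
  have "\<forall>\<^sub>F p in F. \<forall>c\<in>C. \<forall>d\<in>C. dist (M c d p) (?\<delta> c d) < \<epsilon>"
    using M \<open>\<epsilon> > 0\<close> by (intro eventually_ball_finite ballI assms(1) tendstoD)
  then have bound: "\<forall>\<^sub>F p in F. norm (g c p) \<le> 2 * (\<Sum>d\<in>C. \<bar>?y d p\<bar>)"
  proof (rule eventually_mono)
    fix p assume p: "\<forall>c\<in>C. \<forall>d\<in>C. dist (M c d p) (?\<delta> c d) < \<epsilon>"
    let ?G = "\<Sum>c\<in>C. \<bar>g c p\<bar>"
    have "\<bar>g d p\<bar> \<le> \<bar>?y d p\<bar> + ?G * \<epsilon>" if d: "d \<in> C" for d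
    proof -
      have "g d p = (\<Sum>c\<in>C. g c p * ?\<delta> c d)"
        using assms(1) d by (simp add: if_distrib[of "\<lambda>x. _ * x"] cong: if_cong)
      then have "?y d p - g d p = (\<Sum>c\<in>C. g c p * (M c d p - ?\<delta> c d))"
        by (simp only: right_diff_distrib sum_subtractf)
      also have "\<bar>\<dots>\<bar> \<le> (\<Sum>c\<in>C. \<bar>g c p\<bar> * \<epsilon>)"
      proof (rule order_trans[OF sum_abs sum_mono])
        fix c assume "c \<in> C"
        then have "\<bar>M c d p - ?\<delta> c d\<bar> \<le> \<epsilon>"
          using p d by (force simp: dist_real_def intro: less_imp_le)
        then show "\<bar>g c p * (M c d p - ?\<delta> c d)\<bar> \<le> \<bar>g c p\<bar> * \<epsilon>"
          by (simp only: abs_mult) (intro mult_left_mono, auto)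
      qed
      finally show ?thesis by (simp add: sum_distrib_right)
    qed
    then have "?G \<le> (\<Sum>d\<in>C. \<bar>?y d p\<bar> + ?G * \<epsilon>)"
      by (intro sum_mono)
    also have "\<dots> = (\<Sum>d\<in>C. \<bar>?y d p\<bar>) + ?G / 2"
      using card by (simp add: sum.distrib \<epsilon>_def)
    finally have "?G \<le> 2 * (\<Sum>d\<in>C. \<bar>?y d p\<bar>)" by simp
    moreover have "\<bar>g c p\<bar> \<le> ?G"
      using assms(1,4) by (intro member_le_sum) auto
    ultimately show "norm (g c p) \<le> 2 * (\<Sum>d\<in>C. \<bar>?y d p\<bar>)" by simp
  qed
  have "((\<lambda>p. 2 * (\<Sum>d\<in>C. \<bar>?y d p\<bar>)) \<longlongrightarrow> 2 * (\<Sum>d\<in>C. \<bar>0\<bar>)) F"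
    by (intro tendsto_intros y)
  then show ?thesis
    using Lim_null_comparison[OF bound] by simp
qed

section \<open>Distributions spanned by left-invariant fields\<close>

text \<open>Fixes data as provided by \<open>tangent_vector\<close> at one point \<open>q\<close>.
  Tangent vectors become elements of the inner product space \<open>'e\<close>, where bases and
  expansions are available.\<close>

locale tangent_space_at = lie_group G A
  for G :: "'a::{t2_space, second_countable_topology} monoid" (structure)
    and A :: "('a, 'e::real_inner) atlas" +
  fixes q :: 'a and U :: "'a set" and \<phi> :: "'a \<Rightarrow> 'e"
    and T :: "'a vfield \<Rightarrow> 'e" and h :: "'e \<Rightarrow> 'a \<Rightarrow> real"
  assumes chart: "(U, \<phi>) \<in> A" "q \<in> U"
    and h_smooth: "\<And>v. h v \<in> smooth_functions A"
    and T_inner: "\<And>X v. X \<in> vector_fields A \<Longrightarrow> X (h v) q = T X \<bullet> v"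
    and T_derivative: "\<And>X f. X \<in> vector_fields A \<Longrightarrow> f \<in> smooth_functions A \<Longrightarrow>
      X f q = frechet_derivative (f \<circ> inv_into U \<phi>) (at (\<phi> q)) (T X)"
begin

lemma T_eqI: "X \<in> vector_fields A \<Longrightarrow> (\<And>v. X (h v) q = w \<bullet> v) \<Longrightarrow> T X = w"
  by (metis T_inner vector_eq_rdot)

lemma T_add: "X \<in> vector_fields A \<Longrightarrow> Y \<in> vector_fields A \<Longrightarrow> T (X + Y) = T X + T Y"
  by (intro T_eqI vector_fields_add) (simp_all add: T_inner inner_add_left)

lemma T_scale: "X \<in> vector_fields A \<Longrightarrow> T (scaleC c X) = c *\<^sub>R T X"
  by (intro T_eqI vector_fields_scaleC) (simp_all add: T_inner scaleF_def)

lemma T_zero: "T 0 = 0"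
  by (intro T_eqI vector_fields_zero) simp

lemma T_linear_combination:
  "(\<And>i. i \<in> I \<Longrightarrow> X i \<in> vector_fields A) \<Longrightarrow>
    T (\<Sum>i\<in>I. scaleC (a i) (X i)) = (\<Sum>i\<in>I. a i *\<^sub>R T (X i))"
  by (induction I rule: infinite_finite_induct)
    (simp_all add: T_zero T_add T_scale vector_fields_scaleC vector_fields_sum)

lemma left_invariant_eq_if_T_eq: "X \<in> LI \<Longrightarrow> Y \<in> LI \<Longrightarrow> T X = T Y \<Longrightarrow> X = Y"
  by (rule left_invariant_eqI[of _ _ q]) (simp_all add: T_derivative left_invariant_vector_field)

lemma left_invariant_frame:
  assumes D: "lie_subalgebra D LI"
  obtains C E where "orthonormal C" "\<And>c. c \<in> C \<Longrightarrow> E c \<in> D" "\<And>c. c \<in> C \<Longrightarrow> T (E c) = c"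
    "\<And>X. X \<in> D \<Longrightarrow> X = (\<Sum>c\<in>C. scaleC (T X \<bullet> c) (E c))"
proof -
  note D' = lie_subalgebraD[OF D]
  have vf: "X \<in> vector_fields A" if "X \<in> D" for X
    by (rule left_invariant_vector_field[OF D'(1)[OF that]])
  have "subspace (T ` D)"
    unfolding subspace_def
  proof (intro conjI ballI allI)
    show "0 \<in> T ` D" using T_zero D'(2) by (metis image_eqI)
    show "x + y \<in> T ` D" if "x \<in> T ` D" "y \<in> T ` D" for x y
    proof -
      obtain X Y where "X \<in> D" "Y \<in> D" "x = T X" "y = T Y" using \<open>x \<in> T ` D\<close> \<open>y \<in> T ` D\<close> by auto
      then have "x + y = T (X + Y)" "X + Y \<in> D" by (simp_all add: T_add vf D'(3))
      then show ?thesis by simp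
    qed
    show "c *\<^sub>R x \<in> T ` D" if "x \<in> T ` D" for c x
    proof -
      obtain X where "X \<in> D" "x = T X" using \<open>x \<in> T ` D\<close> by auto
      then have "c *\<^sub>R x = T (scaleC c X)" "scaleC c X \<in> D" by (simp_all add: T_scale vf D'(4))
      then show ?thesis by simp
    qed
  qed
  then obtain C where C: "orthonormal C" "span C = T ` D"
    using finite_dim orthonormal_basis_subspace by metis
  have "\<exists>X\<in>D. T X = c" if "c \<in> C" for c
    using C(2) span_base[OF that] by force
  then obtain E where E: "\<And>c. c \<in> C \<Longrightarrow> E c \<in> D \<and> T (E c) = c"
    by metis
  show thesis
  proof (rule that[OF C(1)])
    fix X assume X: "X \<in> D"
    let ?Y = "\<Sum>c\<in>C. scaleC (T X \<bullet> c) (E c)"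
    have "T ?Y = (\<Sum>c\<in>C. (T X \<bullet> c) *\<^sub>R c)"
      using E vf by (subst T_linear_combination) auto
    also have "\<dots> = T X"
      using X C(2) by (intro orthonormal_expand[OF C(1)]) auto
    finally have "T X = T ?Y" by simp
    then show "X = ?Y"
      by (intro left_invariant_eq_if_T_eq D'(1) X lie_subalgebra_linear_combination[OF D])
        (use E in auto)
  qed (use E in auto)
qed

text \<open>The frame built at \<open>q\<close> frames the fibers at every \<open>p\<close>, so the
  neighbourhood may be the whole group: the expansion of an element of \<open>D\<close> is an
  identity of fields, and independence at \<open>p\<close> follows from left-invariance.\<close>

lemma fibers_smooth_distribution:
  assumes D: "lie_subalgebra D LI"
  shows "\<exists>k. smooth_distribution A k (fibers D)"
proof -
  note D' = lie_subalgebraD[OF D]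
  obtain C E where C: "orthonormal C" and E: "\<And>c. c \<in> C \<Longrightarrow> E c \<in> D" "\<And>c. c \<in> C \<Longrightarrow> T (E c) = c"
    and expand: "\<And>X. X \<in> D \<Longrightarrow> X = (\<Sum>c\<in>C. scaleC (T X \<bullet> c) (E c))"
    by (rule left_invariant_frame[OF D]) blast
  define k where "k = card C"
  have "finite C" using C by (simp add: orthonormal_def)
  then obtain e where e: "bij_betw e {..<k} C"
    using ex_bij_betw_nat_finite k_def by (metis atLeast0LessThan)
  have eC: "e i \<in> C" if "i < k" for i
    using e that by (auto simp: bij_betw_def)
  have vf: "E (e i) \<in> vector_fields A" if "i < k" for i
    by (intro left_invariant_vector_field D'(1) E(1) eC that)
  let ?comb = "\<lambda>a. \<Sum>i<k. scaleC (a i) (E (e i))"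
  have comb: "?comb a \<in> D" for a
    using E(1) eC by (intro lie_subalgebra_linear_combination[OF D]) auto
  have "smooth_distribution A k (fibers D)"
    unfolding smooth_distribution_def
  proof (intro allI exI[of _ UNIV] exI[of _ "\<lambda>i. E (e i)"] conjI ballI impI)
    show "E (e i) \<in> vector_fields A" if "i < k" for i by (rule vf[OF that])
    fix p
    have vec_at_comb: "vec_at (?comb a) p = (\<lambda>f. \<Sum>i<k. a i * vec_at (E (e i)) p f)" for a
      by (simp add: vec_at_def linear_combination_apply)
    show "fibers D p = range (\<lambda>a f. \<Sum>i<k. a i * vec_at (E (e i)) p f)"
    proof
      show "range (\<lambda>a f. \<Sum>i<k. a i * vec_at (E (e i)) p f) \<subseteq> fibers D p"
        unfolding vec_at_comb[symmetric] using comb by (auto simp: fibers_def)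
      show "fibers D p \<subseteq> range (\<lambda>a f. \<Sum>i<k. a i * vec_at (E (e i)) p f)"
      proof
        fix v assume "v \<in> fibers D p"
        then obtain X where X: "X \<in> D" "v = vec_at X p" by (auto simp: fibers_def)
        have "X = ?comb (\<lambda>i. T X \<bullet> e i)"
          using expand[OF X(1)] sum.reindex_bij_betw[OF e, of "\<lambda>c. scaleC (T X \<bullet> c) (E c)"]
          by simp
        then have "v = (\<lambda>f. \<Sum>i<k. (T X \<bullet> e i) * vec_at (E (e i)) p f)"
          using vec_at_comb[of "\<lambda>i. T X \<bullet> e i"] X(2) by simp
        then show "v \<in> range (\<lambda>a f. \<Sum>i<k. a i * vec_at (E (e i)) p f)"
          by (intro range_eqI[of _ _ "\<lambda>i. T X \<bullet> e i"])
      qed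
    qed
    fix a i assume "\<forall>f. (\<Sum>i<k. a i * vec_at (E (e i)) p f) = 0" and i: "i < k"
    \<comment> \<open>A left-invariant field vanishing at \<open>p\<close> vanishes everywhere;
      applying \<open>T\<close> at \<open>q\<close> then turns the relation into one between
      orthonormal vectors.\<close>
    then have "?comb a = 0"
      using left_invariant_eqI[of "?comb a" 0 p] D'(1)[OF comb] D'(1)[OF D'(2)]
      by (simp add: vec_at_def linear_combination_apply)
    then have "(\<Sum>j<k. a j *\<^sub>R e j) = 0"
      using T_linear_combination[of "{..<k}" "\<lambda>i. E (e i)" a] vf E(2) eC T_zero by simp
    then have "0 = (\<Sum>j<k. a j * (e j \<bullet> e i))"
      by (metis (no_types, lifting) inner_scaleR_left inner_sum_left inner_zero_left sum.cong)
    also have "\<dots> = (\<Sum>j<k. if j = i then a j else 0)"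
    proof (intro sum.cong refl)
      fix j assume "j \<in> {..<k}"
      then have "e j = e i \<longleftrightarrow> j = i"
        using e i by (auto simp: bij_betw_def inj_on_def)
      then show "a j * (e j \<bullet> e i) = (if j = i then a j else 0)"
        using C eC i \<open>j \<in> {..<k}\<close> by (auto simp: orthonormal_def)
    qed
    finally show "a i = 0" using i by simp
  qed auto
  then show ?thesis by blast
qed

section \<open>Involutivity at a point\<close>

text \<open>No regularity of the coefficients \<open>g\<close> is assumed. Evaluating
  \<open>Y\<close> on the functions \<open>h d\<close> gives a linear system for them whose matrix
  is the identity at \<open>q\<close>, whence \<open>g\<close> is continuous there. As every
  \<open>E c f\<close> vanishes at \<open>q\<close>, continuity suffices to differentiate
  \<open>Y f\<close>, by \<open>has_derivative_mult_vanishing\<close>.\<close>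

lemma tangent_to_second_derivative:
  assumes C: "orthonormal C" and E: "\<And>c. c \<in> C \<Longrightarrow> E c \<in> vector_fields A"
    and TE: "\<And>c. c \<in> C \<Longrightarrow> T (E c) = c"
    and Y: "Y \<in> vector_fields A" "\<And>f p. Y f p = (\<Sum>c\<in>C. g c p * E c f p)"
    and Z: "Z \<in> vector_fields A"
    and f: "f \<in> smooth_functions A" "\<And>c. c \<in> C \<Longrightarrow> E c f q = 0"
  shows "Z (Y f) q = (\<Sum>c\<in>C. g c q * Z (E c f) q)"
proof -
  let ?i = "inv_into U \<phi>" and ?a = "\<phi> q"
  note ch = chartD[OF chart(1)]
  have iq: "?i ?a = q" using ch(3) chart(2) by simp
  have aU: "?a \<in> \<phi> ` U" using chart(2) by simp
  have "isCont ?i ?a"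
    using ch(2,5) chart(2) by (simp add: continuous_on_eq_continuous_at)
  have fin: "finite C" using C by (simp add: orthonormal_def)
  have g: "isCont (g c) q" if "c \<in> C" for c
  proof -
    have "((\<lambda>p. g c p - g c q) \<longlongrightarrow> 0) (at q)"
    proof (rule coefficients_tendsto_0[where M = "\<lambda>c d. E c (h d)", OF fin _ _ that])
      fix c d assume cd: "c \<in> C" "d \<in> C"
      have "(E c (h d) \<longlongrightarrow> E c (h d) q) (at q)"
        using smooth_functions_continuous_at[OF vector_fieldD(1)[OF E[OF cd(1)] h_smooth]]
        by (simp add: isCont_def)
      moreover have "E c (h d) q = (if c = d then 1 else 0)"
        using T_inner[OF E[OF cd(1)], of d] TE[OF cd(1)] C cd by (simp add: orthonormal_def)
      ultimately show "(E c (h d) \<longlongrightarrow> (if c = d then 1 else 0)) (at q)" by simp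
    next
      fix d assume "d \<in> C"
      \<comment> \<open>This limit is 0 by \<open>Y(2)\<close> at \<open>q\<close>; replacing
        \<open>g c p\<close> by \<open>g c p - g c q\<close> has turned continuity into convergence
        to 0.\<close>
      have "((\<lambda>p. Y (h d) p - (\<Sum>c\<in>C. g c q * E c (h d) p)) \<longlongrightarrow>
          Y (h d) q - (\<Sum>c\<in>C. g c q * E c (h d) q)) (at q)"
        using smooth_functions_continuous_at[OF vector_fieldD(1)[OF Y(1) h_smooth]]
          smooth_functions_continuous_at[OF vector_fieldD(1)[OF E h_smooth]]
        by (intro tendsto_intros) (auto simp: isCont_def)
      then show "((\<lambda>p. \<Sum>c\<in>C. (g c p - g c q) * E c (h d) p) \<longlongrightarrow> 0) (at q)"
        by (simp add: Y(2) left_diff_distrib sum_subtractf)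
    qed
    then show ?thesis by (simp add: isCont_def LIM_zero_iff)
  qed
  let ?D = "\<lambda>c. frechet_derivative (E c f \<circ> ?i) (at ?a)"
  have "((\<lambda>x. g c (?i x) * (E c f \<circ> ?i) x) has_derivative (\<lambda>v. g c (?i ?a) * ?D c v)) (at ?a)"
    if c: "c \<in> C" for c
  proof (rule has_derivative_mult_vanishing)
    show "isCont (\<lambda>x. g c (?i x)) ?a"
      using isCont_o2[OF \<open>isCont ?i ?a\<close>] g[OF c] iq by simp
    show "((E c f \<circ> ?i) has_derivative ?D c) (at ?a)"
      by (rule Ck_on_Suc_has_derivative[OF smooth_functions_Ck[OF _ chart(1)] aU])
        (rule vector_fieldD(1)[OF E[OF c] f(1)])
    show "(E c f \<circ> ?i) ?a = 0" using f(2)[OF c] iq by simp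
  qed
  then have "((\<lambda>x. \<Sum>c\<in>C. g c (?i x) * (E c f \<circ> ?i) x) has_derivative
      (\<lambda>v. \<Sum>c\<in>C. g c (?i ?a) * ?D c v)) (at ?a)"
    by (rule has_derivative_sum)
  moreover have "(\<lambda>x. \<Sum>c\<in>C. g c (?i x) * (E c f \<circ> ?i) x) = Y f \<circ> ?i"
    by (simp add: o_def Y(2))
  ultimately have "((Y f \<circ> ?i) has_derivative (\<lambda>v. \<Sum>c\<in>C. g c (?i ?a) * ?D c v)) (at ?a)"
    by (simp only:)
  then have "frechet_derivative (Y f \<circ> ?i) (at ?a) = (\<lambda>v. \<Sum>c\<in>C. g c (?i ?a) * ?D c v)"
    by (rule frechet_derivative_at[symmetric])
  then have "Z (Y f) q = (\<Sum>c\<in>C. g c q * ?D c (T Z))"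
    using T_derivative[OF Z vector_fieldD(1)[OF Y(1) f(1)]] iq by simp
  also have "\<dots> = (\<Sum>c\<in>C. g c q * Z (E c f) q)"
    using T_derivative[OF Z vector_fieldD(1)[OF E f(1)]] by (intro sum.cong) auto
  finally show ?thesis .
qed

lemma lie_bracket_tangent_at:
  assumes D: "lie_subalgebra D LI"
    and X: "X \<in> vector_fields A" "tangent_to X (fibers D)"
    and Y: "Y \<in> vector_fields A" "tangent_to Y (fibers D)"
  shows "vec_at (lie_bracket X Y) q \<in> fibers D q"
proof -
  note D' = lie_subalgebraD[OF D]
  obtain C E where C: "orthonormal C" and E: "\<And>c. c \<in> C \<Longrightarrow> E c \<in> D" "\<And>c. c \<in> C \<Longrightarrow> T (E c) = c"
    and expand: "\<And>X. X \<in> D \<Longrightarrow> X = (\<Sum>c\<in>C. scaleC (T X \<bullet> c) (E c))"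
    by (rule left_invariant_frame[OF D]) blast
  have fin: "finite C" using C by (simp add: orthonormal_def)
  have Evf: "E c \<in> vector_fields A" if "c \<in> C" for c
    by (intro left_invariant_vector_field D'(1) E(1) that)
  \<comment> \<open>At each \<open>p\<close> some element \<open>u p\<close> of \<open>D\<close> has
    the same tangent vector as \<open>X\<close>. These choices are unrelated for different
    \<open>p\<close>; the coefficients are those of \<open>u p\<close> in the global frame.\<close>
  have coeffs: "\<exists>g. \<forall>f p. X f p = (\<Sum>c\<in>C. g c p * E c f p)" if X: "tangent_to X (fibers D)" for X
  proof -
    have "\<exists>u\<in>D. vec_at X p = vec_at u p" for p
      using X by (force simp: tangent_to_def fibers_def)
    then obtain u where u: "\<And>p. u p \<in> D" "\<And>p. vec_at X p = vec_at (u p) p"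
      by metis
    have "X f p = (\<Sum>c\<in>C. (T (u p) \<bullet> c) * E c f p)" for f p
    proof -
      have "X f p = u p f p" using u(2)[of p] by (metis vec_at_def)
      also have "\<dots> = (\<Sum>c\<in>C. scaleC (T (u p) \<bullet> c) (E c)) f p"
        using expand[OF u(1)[of p]] by simp
      finally show ?thesis by (simp add: linear_combination_apply)
    qed
    then show ?thesis
      by (intro exI[of _ "\<lambda>c p. T (u p) \<bullet> c"]) simp
  qed
  obtain a where a: "\<And>f p. X f p = (\<Sum>c\<in>C. a c p * E c f p)"
    using coeffs[OF X(2)] by blast
  obtain b where b: "\<And>f p. Y f p = (\<Sum>c\<in>C. b c p * E c f p)"
    using coeffs[OF Y(2)] by blast
  define W where "W = lie_bracket X Y"
  have W: "W \<in> vector_fields A"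
    unfolding W_def by (rule vector_fields_lie_bracket[OF X(1) Y(1)])
  have vanish: "W f q = 0" if f: "f \<in> smooth_functions A" "\<And>c. c \<in> C \<Longrightarrow> E c f q = 0" for f
  proof -
    note second = tangent_to_second_derivative[OF C Evf E(2) _ _ _ f]
    \<comment> \<open>The bracket of two frame fields lies in \<open>D\<close>, so it is a
      combination of frame fields, all of which kill \<open>f\<close> at \<open>q\<close>. This is
      where closure of \<open>D\<close> under brackets enters.\<close>
    have bracket: "E c (E d f) q = E d (E c f) q" if "c \<in> C" "d \<in> C" for c d
    proof -
      have "lie_bracket (E c) (E d) \<in> D" by (intro D'(5) E that)
      from arg_cong[OF expand[OF this], of "\<lambda>Z. Z f q"]
      have "lie_bracket (E c) (E d) f q = (\<Sum>e\<in>C. (T (lie_bracket (E c) (E d)) \<bullet> e) * E e f q)"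
        by (simp only: linear_combination_apply)
      then have "lie_bracket (E c) (E d) f q = 0"
        by (simp add: f(2))
      then show ?thesis by (simp add: lie_bracket_def)
    qed
    have "X (Y f) q = (\<Sum>c\<in>C. a c q * E c (Y f) q)" by (rule a)
    also have "\<dots> = (\<Sum>c\<in>C. a c q * (\<Sum>d\<in>C. b d q * E c (E d f) q))"
      by (intro sum.cong refl arg_cong2[of _ _ _ _ "(*)"] second[OF _ _ Y(1) b Evf])
    also have "\<dots> = (\<Sum>c\<in>C. \<Sum>d\<in>C. b d q * (a c q * E d (E c f) q))"
      using bracket by (auto simp: sum_distrib_left mult.left_commute intro!: sum.cong)
    also have "\<dots> = (\<Sum>d\<in>C. \<Sum>c\<in>C. b d q * (a c q * E d (E c f) q))"
      by (rule sum.swap)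
    also have "\<dots> = (\<Sum>d\<in>C. b d q * E d (X f) q)"
      using second[OF _ _ X(1) a Evf] by (auto simp: sum_distrib_left intro!: sum.cong)
    also have "\<dots> = Y (X f) q" by (rule b[symmetric])
    finally show ?thesis by (simp add: W_def lie_bracket_def)
  qed
  have "W f q = (\<Sum>c\<in>C. scaleC (W (h c) q) (E c)) f q" for f
  proof (cases "f \<in> smooth_functions A")
    case f: True
    \<comment> \<open>At \<open>q\<close> every frame field gives \<open>f1\<close> and
      \<open>f\<close> the same derivative, so \<open>vanish\<close> applies to
      \<open>f - f1\<close> and \<open>W f q\<close> is read off from \<open>f1\<close>.\<close>
    define f1 where "f1 = (\<lambda>p. \<Sum>c\<in>C. E c f q * h c p)"
    have "f1 = (\<Sum>c\<in>C. (\<lambda>p. E c f q * h c p))"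
      by (auto simp: f1_def sum_fun_apply)
    then have f1: "f1 \<in> smooth_functions A"
      by (simp add: smooth_functions_sum smooth_functions_scale h_smooth)
    have Zf1: "Z f1 q = (\<Sum>c\<in>C. E c f q * Z (h c) q)" if "Z \<in> vector_fields A" for Z
      unfolding f1_def by (subst vector_field_linear_combination[OF that h_smooth]) simp
    have "W (f - f1) q = 0"
    proof (rule vanish)
      show "f - f1 \<in> smooth_functions A" by (rule smooth_functions_diff[OF f f1])
      fix d assume d: "d \<in> C"
      have "E d f1 q = (\<Sum>c\<in>C. E c f q * (if d = c then 1 else 0))"
        unfolding Zf1[OF Evf[OF d]]
        using T_inner[OF Evf[OF d]] E(2)[OF d] C d by (intro sum.cong) (auto simp: orthonormal_def)
      also have "\<dots> = E d f q"
        using fin d by (simp add: if_distrib[of "\<lambda>x. _ * x"] cong: if_cong)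
      finally show "E d (f - f1) q = 0"
        by (simp add: vector_field_diff[OF Evf[OF d] f f1])
    qed
    then have "W f q = W f1 q"
      by (simp add: vector_field_diff[OF W f f1])
    then show ?thesis
      by (simp add: Zf1[OF W] linear_combination_apply mult.commute)
  next
    case False
    then show ?thesis
      using vector_fieldD(2)[OF W] vector_fieldD(2)[OF Evf] by (simp add: linear_combination_apply)
  qed
  then have "vec_at W q = vec_at (\<Sum>c\<in>C. scaleC (W (h c) q) (E c)) q"
    unfolding vec_at_def by (rule ext)
  moreover have "(\<Sum>c\<in>C. scaleC (W (h c) q) (E c)) \<in> D"
    by (rule lie_subalgebra_linear_combination[OF D E(1)])
  ultimately show ?thesis
    unfolding W_def[symmetric] fibers_def by (rule image_eqI)
qed

end

context lie_group
begin

lemma tangent_space_at_exists: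
  obtains U \<phi> T h where "tangent_space_at G A q U \<phi> T h"
proof -
  obtain U \<phi> where c: "(U, \<phi>) \<in> A" "q \<in> U" by (rule chart_at)
  show thesis
  proof (rule tangent_vector[OF c])
    fix T h
    assume "\<And>v. h v \<in> smooth_functions A"
      "\<And>X v. X \<in> vector_fields A \<Longrightarrow> X (h v) q = T X \<bullet> v"
      "\<And>X f. X \<in> vector_fields A \<Longrightarrow> f \<in> smooth_functions A \<Longrightarrow>
        X f q = frechet_derivative (f \<circ> inv_into U \<phi>) (at (\<phi> q)) (T X)"
    with c have "tangent_space_at G A q U \<phi> T h"
      by unfold_locales auto
    then show thesis by (rule that)
  qed
qed

text \<open>A frame found at the identity already gives the rank everywhere, while the bracket
  condition is tested at each point in a chart around it.\<close>

theorem fibers_involutive: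
  assumes D: "lie_subalgebra D LI"
  shows "involutive_distribution A (fibers D)"
  unfolding involutive_distribution_def
proof (intro conjI ballI impI)
  obtain U \<phi> T h where "tangent_space_at G A \<one> U \<phi> T h"
    by (rule tangent_space_at_exists)
  then show "\<exists>k. smooth_distribution A k (fibers D)"
    by (rule tangent_space_at.fibers_smooth_distribution[OF _ D])
next
  fix X Y
  assume XY: "X \<in> vector_fields A" "Y \<in> vector_fields A"
    "tangent_to X (fibers D)" "tangent_to Y (fibers D)"
  have "vec_at (lie_bracket X Y) q \<in> fibers D q" for q
  proof -
    obtain U \<phi> T h where "tangent_space_at G A q U \<phi> T h"
      by (rule tangent_space_at_exists)
    then show ?thesis
      by (rule tangent_space_at.lie_bracket_tangent_at[OF _ D XY(1,3,2,4)])
  qed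
  then show "tangent_to (lie_bracket X Y) (fibers D)"
    by (simp add: tangent_to_def)
qed

end

section \<open>The Poisson-algebra distribution\<close>

context F_Lie_group
begin

lemma S_zero_left: "Z \<in> vector_fields A \<Longrightarrow> S 0 Z = 0"
  using S_add_left[OF vector_fields_zero vector_fields_zero] by fastforce

lemma S_zero_right: "Z \<in> vector_fields A \<Longrightarrow> S Z 0 = 0"
  using S_zero_left S_commute vector_fields_zero by metis

lemma S_scaleC_left:
  "X \<in> vector_fields A \<Longrightarrow> Y \<in> vector_fields A \<Longrightarrow> S (scaleC c X) Y = scaleC c (S X Y)"
  by (rule S_scale_left[OF smooth_functions_const])

lemma S_scaleC_right:
  "X \<in> vector_fields A \<Longrightarrow> Y \<in> vector_fields A \<Longrightarrow> S X (scaleC c Y) = scaleC c (S X Y)"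
  by (rule S_scale_right[OF smooth_functions_const])

lemma S_diff_left:
  assumes "X \<in> vector_fields A" "Y \<in> vector_fields A" "Z \<in> vector_fields A"
  shows "S (X - Y) Z = S X Z - S Y Z"
proof -
  have "X - Y = X + scaleC (-1) Y" "S X Z - S Y Z = S X Z + scaleC (-1) (S Y Z)"
    by (auto simp: scaleF_def fun_eq_iff)
  then show ?thesis
    using assms by (simp only: S_add_left S_scaleC_left vector_fields_scaleC)
qed

lemma S_diff_right:
  assumes "X \<in> vector_fields A" "Y \<in> vector_fields A" "Z \<in> vector_fields A"
  shows "S Z (X - Y) = S Z X - S Z Y"
proof -
  have "X - Y = X + scaleC (-1) Y" "S Z X - S Z Y = S Z X + scaleC (-1) (S Z Y)"
    by (auto simp: scaleF_def fun_eq_iff)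
  then show ?thesis
    using assms by (simp only: S_add_right S_scaleC_right vector_fields_scaleC)
qed

lemma lie_bracket_jacobi:
  assumes "X \<in> vector_fields A" "Y \<in> vector_fields A" "Z \<in> vector_fields A"
  shows "lie_bracket (lie_bracket X Y) Z =
    lie_bracket X (lie_bracket Y Z) - lie_bracket Y (lie_bracket X Z)"
proof
  fix f
  note vf = assms[THEN vector_fieldD(1)] and zero = assms[THEN vector_fieldD(2)]
  show "lie_bracket (lie_bracket X Y) Z f =
      (lie_bracket X (lie_bracket Y Z) - lie_bracket Y (lie_bracket X Z)) f"
  proof (cases "f \<in> smooth_functions A")
    case True
    then show ?thesis
      by (simp add: lie_bracket_def vf assms[THEN vector_field_diff] algebra_simps)
  next
    case False
    then show ?thesis
      by (simp add: lie_bracket_def zero assms[THEN vector_field_zero])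
  qed
qed

text \<open>States the vanishing of the Leibnizator as a product rule for the bracket with
  \<open>u\<close>, the form used for rewriting below.\<close>

lemma D_Pois_iff:
  "u \<in> D_Pois G A S \<longleftrightarrow> u \<in> left_invariant_fields G A \<and>
    (\<forall>Y\<in>vector_fields A. \<forall>Z\<in>vector_fields A.
      lie_bracket u (S Y Z) = S (lie_bracket u Y) Z + S Y (lie_bracket u Z))"
  by (auto simp: D_Pois_def leibnizator_def diff_diff_eq)

lemma D_Pois_lie_subalgebra: "lie_subalgebra (D_Pois G A S) (left_invariant_fields G A)"
  unfolding lie_subalgebra_def
proof (intro conjI ballI allI)
  note LI' = lie_subalgebraD[OF left_invariant_lie_subalgebra]
    and br = vector_fields_lie_bracket
  show "D_Pois G A S \<subseteq> left_invariant_fields G A"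
    by (auto simp: D_Pois_iff)
  show "0 \<in> D_Pois G A S"
  proof -
    have "lie_bracket 0 Y = 0" if "Y \<in> vector_fields A" for Y :: "'a vfield"
      using vector_field_zero[OF that] by (simp add: lie_bracket_def fun_eq_iff)
    then show ?thesis
      by (simp add: D_Pois_iff LI'(2) S_closed S_zero_left S_zero_right)
  qed
  fix u assume u: "u \<in> D_Pois G A S"
  then have u': "u \<in> left_invariant_fields G A" "u \<in> vector_fields A"
    and du: "\<And>Y Z. Y \<in> vector_fields A \<Longrightarrow> Z \<in> vector_fields A \<Longrightarrow>
      lie_bracket u (S Y Z) = S (lie_bracket u Y) Z + S Y (lie_bracket u Z)"
    by (auto simp: D_Pois_iff left_invariant_vector_field)
  show "scaleC c u \<in> D_Pois G A S" for c
  proof -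
    have "lie_bracket (scaleC c u) Y = scaleC c (lie_bracket u Y)" if "Y \<in> vector_fields A" for Y
    proof
      fix f
      \<comment> \<open>For \<open>f\<close> outside the smooth functions \<open>u f\<close> is 0,
        so homogeneity of \<open>Y\<close> is needed only on smooth functions and on 0.\<close>
      have "Y (\<lambda>p. c * u f p) = (\<lambda>p. c * Y (u f) p)"
        by (cases "f \<in> smooth_functions A")
          (use vector_fieldD(4)[OF that vector_fieldD(1)[OF u'(2)]]
            vector_fieldD(2)[OF u'(2)] vector_field_const[OF that, of 0] in
            \<open>auto simp: zero_fun_def\<close>)
      then show "lie_bracket (scaleC c u) Y f = scaleC c (lie_bracket u Y) f"
        by (auto simp: lie_bracket_def scaleF_def times_fun_def fun_diff_def algebra_simps)
    qed
    moreover have "scaleC c (X + Y) = scaleC c X + scaleC c Y" for X Y :: "'a vfield"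
      by (auto simp: scaleF_def fun_eq_iff algebra_simps)
    ultimately show ?thesis
      by (simp add: D_Pois_iff LI'(4) u' du S_closed S_scaleC_left S_scaleC_right br)
  qed
  fix v assume v: "v \<in> D_Pois G A S"
  then have v': "v \<in> left_invariant_fields G A" "v \<in> vector_fields A"
    and dv: "\<And>Y Z. Y \<in> vector_fields A \<Longrightarrow> Z \<in> vector_fields A \<Longrightarrow>
      lie_bracket v (S Y Z) = S (lie_bracket v Y) Z + S Y (lie_bracket v Z)"
    by (auto simp: D_Pois_iff left_invariant_vector_field)
  show "u + v \<in> D_Pois G A S"
  proof -
    have "lie_bracket (u + v) Y = lie_bracket u Y + lie_bracket v Y" if "Y \<in> vector_fields A" for Y
    proof
      fix f
      have "Y (u f + v f) = Y (u f) + Y (v f)"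
        by (cases "f \<in> smooth_functions A")
          (simp_all add: vector_fieldD[OF u'(2)] vector_fieldD[OF v'(2)] vector_fieldD(3)[OF that]
            vector_field_zero[OF that])
      then show "lie_bracket (u + v) Y f = (lie_bracket u Y + lie_bracket v Y) f"
        by (simp add: lie_bracket_def)
    qed
    then show ?thesis
      by (simp add: D_Pois_iff LI'(3) u' v' du dv S_closed S_add_left S_add_right br algebra_simps)
  qed
  show "lie_bracket u v \<in> D_Pois G A S"
  proof -
    have add: "lie_bracket w (X + Y) = lie_bracket w X + lie_bracket w Y"
      if "w \<in> vector_fields A" "X \<in> vector_fields A" "Y \<in> vector_fields A" for w X Y
    proof
      fix f
      have "w (X f + Y f) = w (X f) + w (Y f)"
        by (cases "f \<in> smooth_functions A")
          (simp_all add: vector_fieldD[OF that(2)] vector_fieldD[OF that(3)]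
            vector_fieldD(3)[OF that(1)] vector_field_zero[OF that(1)])
      then show "lie_bracket w (X + Y) f = (lie_bracket w X + lie_bracket w Y) f"
        by (simp add: lie_bracket_def)
    qed
    \<comment> \<open>By the Jacobi identity the bracket with \<open>lie_bracket u v\<close> is the
      commutator of the brackets with \<open>u\<close> and \<open>v\<close>. Expanding it on
      \<open>S Y Z\<close>, the mixed terms, where \<open>u\<close> acts on one factor and
      \<open>v\<close> on the other, are symmetric in \<open>u\<close> and \<open>v\<close> and
      cancel.\<close>
    show ?thesis
      using u' v' by (simp add: D_Pois_iff LI'(5) lie_bracket_jacobi S_closed du dv add br
          S_diff_left S_diff_right)
  qed
qed

end

theorem proposition3p12:
  fixes G :: "'a::{t2_space, second_countable_topology} monoid"
    and A :: "('a, 'e::real_inner) atlas"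
    and S :: "'a vfield \<Rightarrow> 'a vfield \<Rightarrow> 'a vfield"
  assumes "F_Lie_group G A S"
  shows "involutive_distribution A (fibers (D_Pois G A S)) \<and>
         lie_subalgebra (D_Pois G A S) (left_invariant_fields G A)"
proof -
  interpret F_Lie_group G A S by (rule assms)
  show ?thesis
    using D_Pois_lie_subalgebra fibers_involutive by blast
qed

end
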